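(* Let $G=\mathbb{Z}_p\times\mathbb{Z}_q\times\mathbb{Z}_q$ for distinct primes $p$ and $q$ with $p\geq 3\geq q$, let $S$ be a proper subset of $G\setminus\{0\}$ that generates $G$, and let $S_0=S\cup\{0\}$. Let $0\in C\subseteq G$. Put $\mathbf{e}_1=(1,0,0)$. Then $C$ is a perfect code in $\mathrm{Cay}(G,S)$ if and only if there exist two elements $\mathbf{e}_2,\mathbf{e}_3$ generating $\{0\}\times\mathbb{Z}_q\times\mathbb{Z}_q$ and integer parameters such that $(S_0,C)$ is one of the following pairs: (1) $S_0=\{i\mathbf{e}_1+\alpha_i\mathbf{e}_2+\beta_i\mathbf{e}_3\mid i\in[p]\}$, $C=\{i\mathbf{e}_2+j\mathbf{e}_3\mid i,j\in[q]\}$; (2) (only when $q=3$) $S_0=\{\alpha_i\mathbf{e}_1+\alpha_i\mathbf{e}_2+i\mathbf{e}_3\mid i\in[3]\}$, $C=\{i\mathbf{e}_1+j\mathbf{e}_2\mid i\in[p],j\in[3]\}$; (3) (only when $q=3$) $S_0=\{j\mathbf{e}_1+\alpha_i\mathbf{e}_2+i\mathbf{e}_3\mid i\in[3],j\in[p]\}$, $C=\{\lambda_i\mathbf{e}_1+i\mathbf{e}_2\mid i\in[3]\}$; (4) $S_0=\{i\mathbf{e}_1+j\mathbf{e}_2+\alpha_i\mathbf{e}_3\mid i\in[p],j\in[q]\}$, $C=\{\lambda_i\mathbf{e}_2+i\mathbf{e}_3\mid i\in[q]\}$; (5) $S_0=\{i\mathbf{e}_1+\alpha_{ij}\mathbf{e}_2+j\mathbf{e}_3\mid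 i\in[p],j\in[q]\}$, $C=\{i\mathbf{e}_2\mid i\in[q]\}$; (6) $S_0=\{\alpha_i\mathbf{e}_1+j\mathbf{e}_2+i\mathbf{e}_3\mid i,j\in[q]\}$, $C=\{i\mathbf{e}_1+\lambda_i\mathbf{e}_2\mid i\in[p]\}$; (7) $S_0=\{\alpha_{ij}\mathbf{e}_1+i\mathbf{e}_2+j\mathbf{e}_3\mid i,j\in[q]\}$, $C=\{i\mathbf{e}_1\mid i\in[p]\}$.
   Context: Groups are finite abelian, written additively; $\mathbb{Z}_n$ is the group of integers modulo $n$ and $[n]=\{0,1,\dots,n-1\}$. For $S\subseteq G\setminus\{0\}$, $\mathrm{Cay}(G,S)$ is the directed graph with vertex set $G$ and an arc from $x$ to $y$ if and only if $y-x\in S$ ($S$ is not assumed to be inverse-closed). A subset $C\subseteq G$ is a perfect code in $\mathrm{Cay}(G,S)$ if the sets $\{c\}\cup\{v:\text{there is an arc from } c \text{ to } v\}$, $c\in C$, form a partition of $G$. Greek letters with subscripts denote arbitrary integers, one for each value of the displayed indices, subject only to $\alpha_0=\beta_0=\lambda_0=\alpha_{00}=0$; different letters (or index patterns) denote independent families, and an integer occurring several times in one element is the same integer each time. *)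

theory Defs
  imports
    "HOL-Computational_Algebra.Primes"
    "HOL-Library.Disjoint_Sets"
    "HOL-Algebra.Generated_Groups"
    "HOL-Algebra.Elementary_Groups"
    "Graph_Theory.Digraph"
begin

text \<open>
  Groups are written multiplicatively: sums become products, the zero element becomes the
  unit, \<open>y - x\<close> becomes \<open>y \<otimes> inv x\<close> and integer multiples \<open>n x\<close> become powers \<open>x [^] n\<close>.
\<close>

definition cayley_digraph :: "('a, 'm) monoid_scheme \<Rightarrow> 'a set \<Rightarrow> ('a, 'a \<times> 'a) pre_digraph" where
  "cayley_digraph G S =
     \<lparr> verts = carrier G,
       arcs = {(x, y). x \<in> carrier G \<and> y \<in> carrier G \<and> y \<otimes>\<^bsub>G\<^esub> inv\<^bsub>G\<^esub> x \<in> S},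
       tail = fst, head = snd \<rparr>"

definition closed_out_nbhd :: "('a, 'b) pre_digraph \<Rightarrow> 'a \<Rightarrow> 'a set" where
  "closed_out_nbhd D c = {c} \<union> {v. c \<rightarrow>\<^bsub>D\<^esub> v}"

text \<open>
  The closed out-neighbourhoods are required to partition the vertices as a family indexed
  by \<open>C\<close>: distinct codewords have disjoint neighbourhoods, so two codewords may not share one
  and the same neighbourhood. Applying \<^const>\<open>partition_on\<close> to the set of neighbourhoods would
  allow that. The members of the family are nonempty, since each contains its centre.
\<close>

definition perfect_code :: "('a, 'b) pre_digraph \<Rightarrow> 'a set \<Rightarrow> bool" where
  "perfect_code D C \<longleftrightarrow>
     C \<subseteq> verts D \<and>
     disjoint_family_on (closed_out_nbhd D) C \<and>
     (\<Union>c\<in>C. closed_out_nbhd D c) = verts D"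

end

theory Submission
  imports Defs "HOL-Number_Theory.Cong"
begin

text \<open>
  Write \<open>A\<close> for \<open>S\<^sub>0\<close>. The closed out-neighbourhood of \<open>c\<close> is the translate \<open>A c\<close>, so \<open>C\<close> is a
  perfect code exactly when \<open>G = A C\<close> with unique factors (\<open>perfect_code_iff_factorization\<close>), and the
  theorem classifies such factorizations.

  The engine is a rescaling principle (\<open>factorization_power\<close>): if \<open>k\<close> is coprime to the order of \<open>A\<close>,
  then \<open>A\<close> may be replaced by the set of its \<open>k\<close>-th powers. By the Chinese remainder theorem a power map
  of \<open>G\<close> multiplies the \<open>\<int>\<^sub>p\<close>-component by \<open>m\<close> and the component in the plane \<open>\<int>\<^sub>q \<times> \<int>\<^sub>q\<close> by \<open>l\<close>, and
  here \<open>m\<close> and \<open>l\<close> can be prescribed independently, except that \<open>m\<close> must be nonzero if \<open>p\<close> divides the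
  order of \<open>A\<close>, and \<open>l\<close> must be nonzero if \<open>q\<close> does (\<open>scaled_cover\<close>, \<open>scaled_unique\<close>). A zero
  multiplier projects a factor away, a free one forbids differences along a whole direction.

  The orders of \<open>A\<close> and \<open>C\<close> multiply to \<open>p q\<^sup>2\<close>. As \<open>A\<close> generates \<open>G\<close> and is not all of \<open>G\<close>, its order
  is neither \<open>1\<close> nor \<open>p q\<^sup>2\<close>, and one of the factors, say \<open>X\<close> with complement \<open>Y\<close>, has order \<open>p\<close> or \<open>q\<close>.
  The basis of the plane is chosen according to the dimension of the span of the plane components
  of \<open>X\<close> (\<open>dimension_cases\<close>).

  If \<open>X\<close> has order \<open>p\<close>, then \<open>X\<close> is a graph over \<open>\<int>\<^sub>p\<close>, \<open>Y\<close> is a graph over the plane, and the free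
  multiplier \<open>m\<close> makes \<open>Y\<close> invariant under translation by the plane components of \<open>X\<close>
  (\<open>P_translate\<close>). For \<open>X = A\<close> generation forces these to span the plane, so \<open>Y\<close> is the plane. For
  \<open>X = C\<close> the span is zero or a line, since otherwise \<open>A\<close> would be the plane and not generate.

  If \<open>X\<close> has order \<open>q\<close>, then its plane projection is injective and tiles the plane together with
  each fibre of \<open>Y\<close> over \<open>\<int>\<^sub>p\<close>. If it spans a line, it is the line, and the fibres of \<open>Y\<close> are
  transversals of that line. If it spans the plane, then \<open>q = 3\<close>, it is \<open>{0, e\<^sub>3, e\<^sub>2 + 2 e\<^sub>3}\<close> in a
  suitable basis, and since its differences occupy three of the four directions of the plane, every
  fibre of \<open>Y\<close> is a coset of \<open>\<langle>e\<^sub>2\<rangle>\<close> (\<open>triple_fibre_shift\<close>, \<open>triple_fibre\<close>). In both situations, as soon as \<open>X\<close>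
  leaves the plane, the free multiplier \<open>m\<close> forces all fibres of \<open>Y\<close> to be equal. Which of these
  configurations survive is decided by the requirement that \<open>A\<close> generates \<open>G\<close>.
\<close>

section \<open>Rescaling a factor of a finite abelian group\<close>

text \<open>
  The orbits of a map with \<open>k\<close>-th iterate the identity, \<open>k\<close> prime, have size \<open>1\<close> or \<open>k\<close>. Orbits are
  removed one at a time.
\<close>
lemma prime_dvd_card_if_no_fixpoint:
  assumes "finite X" "prime k" "\<And>x. x \<in> X \<Longrightarrow> f x \<in> X"
    and "\<And>x. x \<in> X \<Longrightarrow> (f ^^ k) x = x" "\<And>x. x \<in> X \<Longrightarrow> f x \<noteq> x"
  shows "k dvd card X"
  using assms(1,3-5)
proof (induction X rule: finite_psubset_induct)
  case (psubset X)
  show ?case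
  proof (cases "X = {}")
    case False
    then obtain x where x: "x \<in> X" by blast
    have pw: "(f ^^ i) y \<in> X" if "y \<in> X" for i y
      using that psubset.prems(1) by (induction i) auto
    have pwk: "(f ^^ (b * k)) y = y" if "y \<in> X" for b y
    proof (induction b)
      case (Suc b)
      then show ?case using psubset.prems(2)[OF that] by (simp add: funpow_add)
    qed simp
    define O1 where "O1 = (\<lambda>i. (f ^^ i) x) ` {..<k}"
    have ne: "(f ^^ i) x \<noteq> (f ^^ j) x" if ij: "i < j" "j < k" for i j
    proof
      assume eq: "(f ^^ i) x = (f ^^ j) x"
      define y d where "y = (f ^^ i) x" and "d = j - i"
      have yX: "y \<in> X" using pw x y_def by simp
      \<comment> \<open>Both \<open>d\<close> and \<open>k\<close> are periods of \<open>y\<close>, hence so is their gcd \<open>1\<close>.\<close>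
      have "(f ^^ d) y = y"
        using eq ij unfolding y_def d_def
        by (metis add.commute comp_apply funpow_add le_add_diff_inverse less_imp_le)
      then have pwd: "(f ^^ (a * d)) y = y" for a
        by (induction a) (simp_all add: funpow_add)
      have "d > 0" "d < k" using ij d_def by auto
      then have "coprime d k"
        using \<open>prime k\<close> by (metis coprime_commute nat_dvd_not_less prime_imp_coprime_nat)
      then obtain a b where "a * d = b * k + 1"
        using bezout_nat[of d k] \<open>d > 0\<close> by (metis coprime_iff_gcd_eq_1 mult.commute not_less0 less_numeral_extra(3))
      then have "(f ^^ Suc (b * k)) y = y" using pwd[of a] by simp
      then have "f y = y" using pwk[OF yX, of b] by simp
      then show False using psubset.prems(3) yX by blast
    qed
    have "inj_on (\<lambda>i. (f ^^ i) x) {..<k}"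
      by (rule linorder_inj_onI) (use ne in auto)
    then have cardO: "card O1 = k" unfolding O1_def by (simp add: card_image)
    have k0: "k > 0" using \<open>prime k\<close> prime_gt_0_nat by blast
    have subO: "O1 \<subseteq> X" using pw x O1_def by auto
    have inO: "(f ^^ i) x \<in> O1" for i
    proof -
      have "(f ^^ i) x = (f ^^ (i mod k)) ((f ^^ (i div k * k)) x)"
        by (metis comp_apply funpow_add mod_div_mult_eq)
      also have "\<dots> = (f ^^ (i mod k)) x" using pwk x by simp
      finally show ?thesis using k0 O1_def by auto
    qed
    have "k dvd card (X - O1)"
    proof (rule psubset.IH)
      show "X - O1 \<subset> X" using inO[of 0] x by auto
      show "f z \<in> X - O1" if z: "z \<in> X - O1" for z
      proof -
        have "f z \<notin> O1"
        proof
          assume "f z \<in> O1"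
          then obtain i where i: "f z = (f ^^ i) x" using O1_def by auto
          have "z = (f ^^ (k - 1)) (f z)"
            using psubset.prems(2)[of z] z k0
            by (metis Diff_iff Suc_diff_1 comp_apply funpow_Suc_right)
          also have "\<dots> = (f ^^ (k - 1 + i)) x" using i by (simp add: funpow_add)
          finally show False using inO z by (metis Diff_iff)
        qed
        then show ?thesis using z psubset.prems(1) by blast
      qed
    qed (use psubset.prems in auto)
    moreover have "card X = card (X - O1) + k"
      using cardO subO psubset.hyps by (metis card_Diff_subset card_mono finite_subset le_add_diff_inverse2)
    ultimately show ?thesis by simp
  qed simp
qed

lemma rotate1_fixpoint_imp_replicate:
  assumes "rotate1 xs = xs" "xs \<noteq> []"
  shows "xs = replicate (length xs) (hd xs)"
proof -
  obtain x ys where xs: "xs = x # ys" using assms(2) by (cases xs) auto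
  have "ys @ [x] = x # ys \<Longrightarrow> ys = replicate (length ys) x" for ys
  proof (induction ys)
    case (Cons y ys)
    then have "y = x" "ys @ [x] = x # ys" by auto
    then show ?case using Cons.IH by simp
  qed simp
  then show ?thesis using assms(1) unfolding xs by simp
qed

definition factorization :: "('a, 'm) monoid_scheme \<Rightarrow> 'a set \<Rightarrow> 'a set \<Rightarrow> bool" where
  "factorization G A B \<longleftrightarrow> A \<subseteq> carrier G \<and> B \<subseteq> carrier G \<and>
     bij_betw (\<lambda>(a, b). a \<otimes>\<^bsub>G\<^esub> b) (A \<times> B) (carrier G)"

context comm_group
begin

lemma factorizationD:
  assumes "factorization G A B"
  shows "\<And>a. a \<in> A \<Longrightarrow> a \<in> carrier G" "\<And>b. b \<in> B \<Longrightarrow> b \<in> carrier G"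
    and "\<And>g. g \<in> carrier G \<Longrightarrow> \<exists>a\<in>A. \<exists>b\<in>B. g = a \<otimes> b"
    and "\<And>a a' b b'. \<lbrakk>a \<in> A; a' \<in> A; b \<in> B; b' \<in> B; a \<otimes> b = a' \<otimes> b'\<rbrakk> \<Longrightarrow> a = a' \<and> b = b'"
proof -
  have bij: "bij_betw (\<lambda>(a, b). a \<otimes> b) (A \<times> B) (carrier G)"
    and sub: "A \<subseteq> carrier G" "B \<subseteq> carrier G"
    using assms unfolding factorization_def by auto
  show "\<And>a. a \<in> A \<Longrightarrow> a \<in> carrier G" "\<And>b. b \<in> B \<Longrightarrow> b \<in> carrier G" using sub by auto
  show "\<exists>a\<in>A. \<exists>b\<in>B. g = a \<otimes> b" if "g \<in> carrier G" for g
    using that bij_betw_imp_surj_on[OF bij] by force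
  show "a = a' \<and> b = b'" if "a \<in> A" "a' \<in> A" "b \<in> B" "b' \<in> B" "a \<otimes> b = a' \<otimes> b'" for a a' b b'
    using that inj_onD[OF bij_betw_imp_inj_on[OF bij], of "(a, b)" "(a', b')"] by auto
qed

lemma factorization_card:
  assumes "factorization G A B"
  shows "card A * card B = card (carrier G)"
  using assms bij_betw_same_card unfolding factorization_def by (metis card_cartesian_product)

lemma factorization_commute:
  assumes "factorization G A B"
  shows "factorization G B A"
proof -
  have "bij_betw prod.swap (B \<times> A) (A \<times> B)"
    by (rule bij_betw_imageI) (auto simp: inj_on_def)
  then have "bij_betw ((\<lambda>(a, b). a \<otimes> b) \<circ> prod.swap) (B \<times> A) (carrier G)"
    using assms bij_betw_trans unfolding factorization_def by blast
  moreover have "bij_betw ((\<lambda>(a, b). a \<otimes> b) \<circ> prod.swap) (B \<times> A) (carrier G)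
      = bij_betw (\<lambda>(a, b). a \<otimes> b) (B \<times> A) (carrier G)"
    by (rule bij_betw_cong) (use assms m_comm in \<open>auto simp: factorization_def\<close>)
  ultimately show ?thesis using assms unfolding factorization_def by simp
qed

text \<open>
  As many pairs as group elements: then coverage already forces uniqueness.
\<close>
lemma factorizationI_card:
  assumes "finite (carrier G)" "A \<subseteq> carrier G" "B \<subseteq> carrier G"
    and "\<And>g. g \<in> carrier G \<Longrightarrow> \<exists>a\<in>A. \<exists>b\<in>B. g = a \<otimes> b"
    and "card A * card B \<le> card (carrier G)"
  shows "factorization G A B"
proof -
  let ?f = "\<lambda>(a, b). a \<otimes> b"
  have fin: "finite (A \<times> B)" using assms(1-3) finite_subset by blast
  have im: "?f ` (A \<times> B) = carrier G"
  proof (intro subset_antisym subsetI)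
    show "g \<in> ?f ` (A \<times> B)" if g: "g \<in> carrier G" for g
    proof -
      obtain a b where "a \<in> A" "b \<in> B" "g = a \<otimes> b" using assms(4)[OF g] by blast
      then show ?thesis by (intro image_eqI[of _ _ "(a, b)"]) simp_all
    qed
  qed (use assms(2,3) in auto)
  have "card (A \<times> B) \<le> card (?f ` (A \<times> B))" using im assms(5) by (simp add: card_cartesian_product)
  then have "inj_on ?f (A \<times> B)"
    using fin by (metis card_image_le eq_card_imp_inj_on le_antisym)
  then show ?thesis using im assms(2,3) unfolding factorization_def bij_betw_def by blast
qed

lemma foldr_mult_closed:
  "set xs \<subseteq> carrier G \<Longrightarrow> foldr (\<otimes>) xs \<one> \<in> carrier G"
  by (induction xs) auto

lemma foldr_mult_snoc:
  "\<lbrakk>set xs \<subseteq> carrier G; x \<in> carrier G\<rbrakk> \<Longrightarrow> foldr (\<otimes>) (xs @ [x]) \<one> = x \<otimes> foldr (\<otimes>) xs \<one>"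
  by (induction xs) (auto simp: foldr_mult_closed m_lcomm simp del: foldr_append)

lemma foldr_mult_rotate1:
  "set xs \<subseteq> carrier G \<Longrightarrow> foldr (\<otimes>) (rotate1 xs) \<one> = foldr (\<otimes>) xs \<one>"
  by (cases xs) (simp_all add: foldr_mult_snoc del: foldr_append)

lemma foldr_mult_replicate:
  "a \<in> carrier G \<Longrightarrow> foldr (\<otimes>) (replicate n a) \<one> = a [^] n"
  by (induction n) (simp_all add: m_comm)

text \<open>
  All entries but the first are free: they leave one element of \<open>G\<close> to be factored, which determines
  the first entry and the element of \<open>B\<close>.
\<close>
lemma factorization_tuples_card:
  assumes fac: "factorization G A B" and g: "g \<in> carrier G" and fin: "finite A"
  shows "card {xs. set xs \<subseteq> A \<and> length xs = Suc n \<and> (\<exists>b\<in>B. foldr (\<otimes>) xs \<one> \<otimes> b = g)} = card A ^ n"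
proof -
  note D = factorizationD[OF fac]
  let ?X = "{xs. set xs \<subseteq> A \<and> length xs = Suc n \<and> (\<exists>b\<in>B. foldr (\<otimes>) xs \<one> \<otimes> b = g)}"
  let ?Y = "{ys. set ys \<subseteq> A \<and> length ys = n}"
  have "bij_betw tl ?X ?Y"
  proof (rule bij_betw_imageI)
    show "inj_on tl ?X"
    proof (rule inj_onI)
      fix xs xs' assume xs: "xs \<in> ?X" "xs' \<in> ?X" "tl xs = tl xs'"
      obtain a ys where a: "xs = a # ys" using xs by (cases xs) auto
      obtain a' where a': "xs' = a' # ys" using xs a by (cases xs') auto
      let ?P = "foldr (\<otimes>) ys \<one>"
      have P: "?P \<in> carrier G" using xs a D(1) by (intro foldr_mult_closed) auto
      obtain b b' where b: "b \<in> B" "b' \<in> B" "a \<otimes> ?P \<otimes> b = g" "a' \<otimes> ?P \<otimes> b' = g"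
        using xs a a' by auto
      have aA: "a \<in> A" "a' \<in> A" using xs a a' by auto
      note c = P D(1)[OF aA(1)] D(1)[OF aA(2)] D(2)[OF b(1)] D(2)[OF b(2)]
      have "?P \<otimes> (a \<otimes> b) = ?P \<otimes> (a' \<otimes> b')"
        using b c by (metis m_assoc m_comm)
      then have "a \<otimes> b = a' \<otimes> b'" using c by simp
      then show "xs = xs'" using D(4) aA b a a' by metis
    qed
    show "tl ` ?X = ?Y"
    proof (intro subset_antisym subsetI)
      fix ys assume "ys \<in> tl ` ?X"
      then show "ys \<in> ?Y" by (auto dest: list.set_sel(2)) (metis Nil_tl list.set_sel(2) subset_code(1))
    next
      fix ys assume ys: "ys \<in> ?Y"
      let ?P = "foldr (\<otimes>) ys \<one>"
      have P: "?P \<in> carrier G" using ys D(1) by (intro foldr_mult_closed) auto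
      obtain a b where ab: "a \<in> A" "b \<in> B" "g \<otimes> inv ?P = a \<otimes> b"
        using D(3)[of "g \<otimes> inv ?P"] g P by auto
      note c = P g D(1)[OF ab(1)] D(2)[OF ab(2)]
      have "a \<otimes> ?P \<otimes> b = a \<otimes> b \<otimes> ?P" using c by (metis m_assoc m_comm)
      also have "\<dots> = g" using ab(3)[symmetric] c by (simp add: m_assoc)
      finally have "a # ys \<in> ?X" using ab ys by auto
      then show "ys \<in> tl ` ?X" by (intro image_eqI[of _ _ "a # ys"]) simp_all
    qed
  qed
  then show ?thesis using bij_betw_same_card card_lists_length_eq[OF fin, of n] by fastforce
qed

text \<open>
  The tuples in \<open>A\<^sup>k\<close> whose product times an element of \<open>B\<close> is \<open>g\<close> are permuted by rotation, because
  \<open>G\<close> is abelian. Their number is a power of the order of \<open>A\<close>, hence prime to \<open>k\<close>, so some tuple is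
  fixed. A fixed tuple is constant, and it writes \<open>g\<close> as \<open>a\<^sup>k b\<close>.
\<close>
lemma factorization_power_prime:
  fixes k :: nat
  assumes fac: "factorization G A B" and fin: "finite (carrier G)"
    and k: "prime k" "\<not> k dvd card A"
  shows "factorization G ((\<lambda>a. a [^] k) ` A) B" "inj_on (\<lambda>a. a [^] k) A"
proof -
  note D = factorizationD[OF fac]
  have AB: "A \<subseteq> carrier G" "B \<subseteq> carrier G" using D by auto
  have finA: "finite A" using fin AB finite_subset by blast
  have cover: "\<exists>a\<in>A. \<exists>b\<in>B. g = a [^] k \<otimes> b" if g: "g \<in> carrier G" for g
  proof -
    let ?X = "{xs. set xs \<subseteq> A \<and> length xs = k \<and> (\<exists>b\<in>B. foldr (\<otimes>) xs \<one> \<otimes> b = g)}"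
    have k0: "k > 0" using k prime_gt_0_nat by blast
    have "card ?X = card A ^ (k - 1)"
      using factorization_tuples_card[OF fac g finA, of "k - 1"] k0 by simp
    then have ndvd: "\<not> k dvd card ?X" using k prime_dvd_power by metis
    have "finite ?X" using finite_lists_length_eq[OF finA, of k] by (rule rev_finite_subset) auto
    moreover have "rotate1 xs \<in> ?X" if "xs \<in> ?X" for xs
      using that AB foldr_mult_rotate1[of xs] by auto
    moreover have "(rotate1 ^^ k) xs = xs" if "xs \<in> ?X" for xs
      using that rotate_id[of k xs] by (auto simp: rotate_def)
    ultimately obtain xs where xs: "xs \<in> ?X" "rotate1 xs = xs"
      using prime_dvd_card_if_no_fixpoint[OF _ k(1), of ?X rotate1] ndvd by blast
    have ne: "xs \<noteq> []" using xs k0 by auto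
    define a where "a = hd xs"
    have "xs = replicate k a" "a \<in> A"
      using rotate1_fixpoint_imp_replicate[OF xs(2) ne] xs(1) ne hd_in_set[OF ne] a_def by auto
    then show ?thesis using xs(1) foldr_mult_replicate[of a k] D(1) by auto
  qed
  have le: "card ((\<lambda>a. a [^] k) ` A) \<le> card A" using card_image_le[OF finA] .
  show fac': "factorization G ((\<lambda>a. a [^] k) ` A) B"
  proof (rule factorizationI_card[OF fin])
    show "(\<lambda>a. a [^] k) ` A \<subseteq> carrier G" using AB by auto
    show "card ((\<lambda>a. a [^] k) ` A) * card B \<le> card (carrier G)"
      using le factorization_card[OF fac] by (metis mult_le_mono1)
  qed (use AB cover in auto)
  have "card (carrier G) > 0" using fin one_closed by (metis card_gt_0_iff empty_iff)
  then have "card ((\<lambda>a. a [^] k) ` A) = card A"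
    using factorization_card[OF fac] factorization_card[OF fac'] by (metis mult_right_cancel mult_0_right less_irrefl)
  then show "inj_on (\<lambda>a. a [^] k) A" using finA eq_card_imp_inj_on by blast
qed

lemma factorization_power:
  fixes k :: nat
  assumes "factorization G A B" and fin: "finite (carrier G)"
    and "k > 0" "coprime k (card A)"
  shows "factorization G ((\<lambda>a. a [^] k) ` A) B \<and> inj_on (\<lambda>a. a [^] k) A"
  using assms(1,3,4)
proof (induction k arbitrary: A rule: less_induct)
  case (less k)
  have AG: "A \<subseteq> carrier G" using less.prems(1) unfolding factorization_def by simp
  show ?case
  proof (cases "k = 1")
    case True
    have "(\<lambda>a. a [^] k) ` A = id ` A" by (rule image_cong) (use AG True in auto)
    moreover have "inj_on (\<lambda>a. a [^] k) A = inj_on id A"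
      by (rule inj_on_cong) (use AG True in auto)
    ultimately show ?thesis using less.prems by simp
  next
    case False
    then obtain r where r: "prime r" "r dvd k" using prime_factor_nat by blast
    then obtain m where m: "k = r * m" by blast
    have m0: "m > 0" "m < k" using m r less.prems prime_gt_1_nat[OF r(1)] by auto
    have "\<not> r dvd card A"
      using r less.prems(3) by (meson coprime_common_divisor not_prime_unit)
    note f = factorization_power_prime[OF less.prems(1) fin r(1) this]
    have "coprime m (card ((\<lambda>a. a [^] r) ` A))"
      using less.prems(3) card_image[OF f(2)] m by simp
    note IH = less.IH[OF m0(2) f(1) m0(1) this]
    have "(\<lambda>a. a [^] m) ` (\<lambda>a. a [^] r) ` A = (\<lambda>a. a [^] k) ` A"
      unfolding image_image by (rule image_cong) (use AG m nat_pow_pow in auto)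
    moreover have "inj_on ((\<lambda>a. a [^] m) \<circ> (\<lambda>a. a [^] r)) A" using IH f(2) comp_inj_on by blast
    moreover have "inj_on ((\<lambda>a. a [^] m) \<circ> (\<lambda>a. a [^] r)) A = inj_on (\<lambda>a. a [^] k) A"
      by (rule inj_on_cong) (use AG m nat_pow_pow in auto)
    ultimately show ?thesis using IH by metis
  qed
qed

end

section \<open>Coordinates\<close>

lemma cong_solve_prime:
  fixes r :: nat
  assumes "prime r" "\<not> int r dvd a"
  shows "\<exists>m. [m * a = b] (mod int r)"
proof -
  have "coprime a (int r)"
    using assms by (metis coprime_commute prime_imp_coprime prime_nat_int_transfer)
  then obtain z where "[a * z = 1] (mod int r)" using cong_solve_coprime_int by blast
  then have "[b * (a * z) = b * 1] (mod int r)" by (rule cong_scalar_left)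
  then show ?thesis by (metis mult.assoc mult.commute mult.right_neutral)
qed

lemma prime_dvd_cancel:
  fixes r :: nat
  assumes "prime r" "int r dvd a * b" "\<not> int r dvd b"
  shows "int r dvd a"
  using assms by (metis prime_dvd_mult_iff prime_nat_int_transfer)

lemma residue_representative:
  fixes r :: nat
  assumes "r > 0"
  obtains i :: nat where "i < r" "[x = int i] (mod int r)"
proof
  show "nat (x mod int r) < r" using assms by (simp add: nat_less_iff)
  show "[x = int (nat (x mod int r))] (mod int r)" using assms by simp
qed

definition point :: "('a, 'm) monoid_scheme \<Rightarrow> 'a \<Rightarrow> 'a \<Rightarrow> 'a \<Rightarrow> int \<Rightarrow> int \<Rightarrow> int \<Rightarrow> 'a" where
  "point G e1 e2 e3 x s t = e1 [^]\<^bsub>G\<^esub> x \<otimes>\<^bsub>G\<^esub> e2 [^]\<^bsub>G\<^esub> s \<otimes>\<^bsub>G\<^esub> e3 [^]\<^bsub>G\<^esub> t"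

text \<open>
  A basis adapted to \<open>\<int>\<^sub>p \<times> \<int>\<^sub>q \<times> \<int>\<^sub>q\<close>, recorded only through its coordinate map. Elements are
  handled through arbitrary integer coordinates, so that no reduction modulo \<open>p\<close> or \<open>q\<close> appears in
  terms, and a change of basis is another instance of the same locale with the same \<open>e1\<close>.
\<close>
locale pqq_frame = comm_group G for G (structure) +
  fixes p q :: nat and e1 e2 e3
  assumes prime_p: "prime p" and prime_q: "prime q" and p_neq_q: "p \<noteq> q"
    and e_closed: "e1 \<in> carrier G" "e2 \<in> carrier G" "e3 \<in> carrier G"
    and point_surj: "g \<in> carrier G \<Longrightarrow> \<exists>x s t. g = point G e1 e2 e3 x s t"
    and point_eq_iff: "point G e1 e2 e3 x s t = point G e1 e2 e3 x' s' t' \<longleftrightarrow>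
      [x = x'] (mod int p) \<and> [s = s'] (mod int q) \<and> [t = t'] (mod int q)"
begin

abbreviation "pt \<equiv> point G e1 e2 e3"

lemma p_pos: "p > 0" and q_pos: "q > 0"
  using prime_p prime_q prime_gt_0_nat by auto

lemma point_closed [simp]: "pt x s t \<in> carrier G"
  using e_closed by (simp add: point_def)

lemma point_mult: "pt x s t \<otimes> pt x' s' t' = pt (x + x') (s + s') (t + t')"
  using e_closed by (simp add: point_def int_pow_mult m_ac)

lemma point_zero: "pt 0 0 0 = \<one>"
  by (simp add: point_def)

lemma point_pow: "pt x s t [^] (k :: nat) = pt (int k * x) (int k * s) (int k * t)"
  by (induction k) (simp_all add: point_zero point_mult algebra_simps)

lemma point_inv: "inv (pt x s t) = pt (- x) (- s) (- t)"
  by (rule inv_equality) (simp_all add: point_mult point_zero)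

lemma point_in_cong:
  assumes "pt x s t \<in> A" "[x = x'] (mod int p)" "[s = s'] (mod int q)" "[t = t'] (mod int q)"
  shows "pt x' s' t' \<in> A"
  using assms point_eq_iff by metis

lemma finite_carrier: "finite (carrier G)"
  and card_carrier: "card (carrier G) = p * (q * q)"
proof -
  let ?f = "\<lambda>(i::nat, j::nat, k::nat). pt (int i) (int j) (int k)"
  have "bij_betw ?f ({..<p} \<times> {..<q} \<times> {..<q}) (carrier G)"
  proof (rule bij_betw_imageI)
    show "inj_on ?f ({..<p} \<times> {..<q} \<times> {..<q})"
      by (auto simp: inj_on_def point_eq_iff cong_int_iff cong_less_modulus_unique_nat)
    show "?f ` ({..<p} \<times> {..<q} \<times> {..<q}) = carrier G"
    proof (intro subset_antisym subsetI)
      fix g assume "g \<in> carrier G"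
      then obtain x s t where g: "g = pt x s t" using point_surj by blast
      obtain i where i: "i < p" "[x = int i] (mod int p)" using residue_representative[OF p_pos] .
      obtain j where j: "j < q" "[s = int j] (mod int q)" using residue_representative[OF q_pos] .
      obtain k where k: "k < q" "[t = int k] (mod int q)" using residue_representative[OF q_pos] .
      have "g = ?f (i, j, k)" using g i j k by (simp add: point_eq_iff)
      then show "g \<in> ?f ` ({..<p} \<times> {..<q} \<times> {..<q})" using i j k by blast
    qed auto
  qed
  then show "finite (carrier G)" "card (carrier G) = p * (q * q)"
    using bij_betw_finite bij_betw_same_card by (blast, fastforce simp: card_cartesian_product)
qed

lemma not_p_dvd_q: "\<not> p dvd q" "\<not> q dvd p"
  using prime_p prime_q p_neq_q primes_dvd_imp_eq by blast+

lemma not_p_dvd_qq: "\<not> p dvd q * q"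
  using not_p_dvd_q prime_p prime_dvd_mult_iff by blast

text \<open>
  In the application \<open>n\<close> is the order of a factor; adding \<open>p q\<close> makes the residue positive.
\<close>
lemma scaling_exponent:
  assumes "n dvd p * (q * q)"
    and "p dvd n \<Longrightarrow> \<not> int p dvd m" "q dvd n \<Longrightarrow> \<not> int q dvd l"
  obtains k :: nat where "k > 0" "coprime k n" "[int k = m] (mod int p)" "[int k = l] (mod int q)"
proof -
  obtain m' where m': "[m = int m'] (mod int p)" using residue_representative[OF p_pos] .
  obtain l' where l': "[l = int l'] (mod int q)" using residue_representative[OF q_pos] .
  have "coprime p q" using prime_p prime_q p_neq_q primes_coprime by blast
  then obtain k0 where k0: "[k0 = m'] (mod p)" "[k0 = l'] (mod q)"
    using binary_chinese_remainder_nat by blast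
  define k where "k = k0 + p * q"
  have k: "[k = m'] (mod p)" "[k = l'] (mod q)"
    using k0 unfolding k_def by (simp_all add: cong_def)
  have kc: "[int k = m] (mod int p)" "[int k = l] (mod int q)"
    using k m' l' by (metis cong_int_iff cong_sym cong_trans)+
  have "coprime k n"
  proof (rule ccontr)
    assume "\<not> coprime k n"
    then obtain r where r: "prime r" "r dvd k" "r dvd n"
      by (metis coprime_iff_gcd_eq_1 dvd_gcdD1 dvd_gcdD2 prime_factor_nat)
    then have "r dvd p * (q * q)" using assms(1) dvd_trans by blast
    then have "r dvd p \<or> r dvd q" using r(1) prime_dvd_mult_iff by blast
    then have "r = p \<or> r = q" using primes_dvd_imp_eq prime_p prime_q r(1) by blast
    then show False
    proof
      assume "r = p"
      then have "int p dvd m" using kc(1) r(2) by (metis cong_dvd_iff dvd_refl int_dvd_int_iff cong_dvd_modulus cong_0_iff cong_sym cong_trans)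
      then show False using assms(2) r(3) \<open>r = p\<close> by simp
    next
      assume "r = q"
      then have "int q dvd l" using kc(2) r(2) by (metis cong_dvd_iff dvd_refl int_dvd_int_iff cong_dvd_modulus cong_0_iff cong_sym cong_trans)
      then show False using assms(3) r(3) \<open>r = q\<close> by simp
    qed
  qed
  moreover have "k > 0" unfolding k_def using p_pos q_pos by simp
  ultimately show ?thesis using that kc by blast
qed

text \<open>
  The rescaled factorization in coordinates. Taking \<open>m = 0\<close> or \<open>l = 0\<close> projects \<open>A\<close> onto the plane or
  onto the first axis; letting \<open>m\<close> or \<open>l\<close> vary excludes a whole family of differences at once.
\<close>
lemma scaled_factorization:
  assumes fac: "factorization G A B"
    and m: "p dvd card A \<Longrightarrow> \<not> int p dvd m" and l: "q dvd card A \<Longrightarrow> \<not> int q dvd l"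
  shows scaled_cover: "\<exists>x1 s1 t1. pt x1 s1 t1 \<in> A \<and> pt (x - m * x1) (s - l * s1) (t - l * t1) \<in> B"
    and scaled_unique: "\<lbrakk>pt x1 s1 t1 \<in> A; pt x1' s1' t1' \<in> A; pt x2 s2 t2 \<in> B; pt x2' s2' t2' \<in> B;
      [m * x1 + x2 = m * x1' + x2'] (mod int p); [l * s1 + s2 = l * s1' + s2'] (mod int q);
      [l * t1 + t2 = l * t1' + t2'] (mod int q)\<rbrakk>
     \<Longrightarrow> pt x1 s1 t1 = pt x1' s1' t1' \<and> pt x2 s2 t2 = pt x2' s2' t2'"
proof -
  have "card A dvd p * (q * q)" using factorization_card[OF fac] card_carrier by (metis dvd_triv_left)
  then obtain k where k: "k > 0" "coprime k (card A)" "[int k = m] (mod int p)" "[int k = l] (mod int q)"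
    using scaling_exponent m l by metis
  have f: "factorization G ((\<lambda>a. a [^] k) ` A) B" "inj_on (\<lambda>a. a [^] k) A"
    using factorization_power[OF fac finite_carrier k(1,2)] by auto
  note D = factorizationD[OF f(1)]
  have pk: "pt x1 s1 t1 [^] k = pt (m * x1) (l * s1) (l * t1)" for x1 s1 t1
    using k by (simp add: point_pow point_eq_iff cong_scalar_right)
  show "\<exists>x1 s1 t1. pt x1 s1 t1 \<in> A \<and> pt (x - m * x1) (s - l * s1) (t - l * t1) \<in> B"
  proof -
    obtain a b where ab: "a \<in> A" "b \<in> B" "pt x s t = a [^] k \<otimes> b"
      using D(3)[of "pt x s t"] by auto
    have "a \<in> carrier G" "b \<in> carrier G" using ab factorizationD[OF fac] by auto
    then obtain x1 s1 t1 x2 s2 t2 where c: "a = pt x1 s1 t1" "b = pt x2 s2 t2"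
      using point_surj by metis
    have "pt x s t = pt (m * x1 + x2) (l * s1 + s2) (l * t1 + t2)"
      using ab(3) c pk by (simp add: point_mult)
    then have "pt (x - m * x1) (s - l * s1) (t - l * t1) = b"
      unfolding c(2) point_eq_iff by (simp add: cong_iff_dvd_diff algebra_simps)
    then show ?thesis using ab c by blast
  qed
  assume a: "pt x1 s1 t1 \<in> A" "pt x1' s1' t1' \<in> A" "pt x2 s2 t2 \<in> B" "pt x2' s2' t2' \<in> B"
    "[m * x1 + x2 = m * x1' + x2'] (mod int p)" "[l * s1 + s2 = l * s1' + s2'] (mod int q)"
    "[l * t1 + t2 = l * t1' + t2'] (mod int q)"
  then have "pt x1 s1 t1 [^] k \<otimes> pt x2 s2 t2 = pt x1' s1' t1' [^] k \<otimes> pt x2' s2' t2'"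
    unfolding pk point_mult by (simp add: point_eq_iff)
  then have "pt x1 s1 t1 [^] k = pt x1' s1' t1' [^] k" "pt x2 s2 t2 = pt x2' s2' t2'"
    using D(4) a(1-4) by blast+
  then show "pt x1 s1 t1 = pt x1' s1' t1' \<and> pt x2 s2 t2 = pt x2' s2' t2'"
    using inj_onD[OF f(2) _ a(1,2)] by blast
qed

lemma point_frame_change:
  "point G e1 (pt 0 a b) (pt 0 c d) x s t = pt x (s * a + t * c) (s * b + t * d)"
proof -
  have "pt 0 u v [^] (z :: int) = pt 0 (z * u) (z * v)" for u v z
    using e_closed by (simp add: point_def int_pow_distrib int_pow_pow mult.commute)
  moreover have "e1 [^] x = pt x 0 0" using e_closed by (simp add: point_def)
  ultimately show ?thesis unfolding point_def[of G e1 "pt 0 a b"] by (simp add: point_mult)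
qed

lemma frame_change:
  assumes det: "\<not> int q dvd a * d - b * c"
  shows "pqq_frame G p q e1 (pt 0 a b) (pt 0 c d)"
proof (unfold_locales, goal_cases)
  case (7 g)
  then obtain x s t where g: "g = pt x s t" using point_surj by blast
  obtain D where D: "[D * (a * d - b * c) = 1] (mod int q)"
    using cong_solve_prime[OF prime_q det] by blast
  have "[D * (a * d - b * c) * s = 1 * s] (mod int q)" "[D * (a * d - b * c) * t = 1 * t] (mod int q)"
    using D cong_scalar_right by blast+
  \<comment> \<open>Cramer's rule\<close>
  then have "g = point G e1 (pt 0 a b) (pt 0 c d) x (D * (d * s - c * t)) (D * (a * t - b * s))"
    unfolding g point_frame_change point_eq_iff
    by (auto simp: algebra_simps intro: cong_sym)
  then show ?case by blast
next
  case (8 x s t x' s' t')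
  have "[s = s'] (mod int q) \<and> [t = t'] (mod int q)"
    if *: "[s * a + t * c = s' * a + t' * c] (mod int q)" "[s * b + t * d = s' * b + t' * d] (mod int q)"
  proof -
    have d: "int q dvd (s * a + t * c) - (s' * a + t' * c)" "int q dvd (s * b + t * d) - (s' * b + t' * d)"
      using * by (simp_all add: cong_iff_dvd_diff)
    have "(s - s') * (a * d - b * c) =
        d * ((s * a + t * c) - (s' * a + t' * c)) - c * ((s * b + t * d) - (s' * b + t' * d))"
      "(t - t') * (a * d - b * c) =
        a * ((s * b + t * d) - (s' * b + t' * d)) - b * ((s * a + t * c) - (s' * a + t' * c))"
      by algebra+
    then have "int q dvd (s - s') * (a * d - b * c)" "int q dvd (t - t') * (a * d - b * c)"
      using d by (metis dvd_diff dvd_mult)+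
    from this[THEN prime_dvd_cancel[OF prime_q _ det]] show ?thesis by (simp add: cong_iff_dvd_diff)
  qed
  moreover have "[s * u + t * v = s' * u + t' * v] (mod int q)"
    if "[s = s'] (mod int q)" "[t = t'] (mod int q)" for u v
    using that by (intro cong_add cong_scalar_right)
  ultimately show ?case unfolding point_frame_change point_eq_iff by blast
qed (use prime_p prime_q p_neq_q e_closed in auto)

text \<open>
  The three cases are the possible dimensions of the span of the plane components of \<open>A\<close>. The new basis
  consists of such components as far as possible.
\<close>
lemma dimension_cases:
  assumes A: "A \<subseteq> carrier G"
  obtains (zero) "\<And>g. g \<in> A \<Longrightarrow> \<exists>x. g = pt x 0 0"
  | (one) f2 f3 x1 where "pqq_frame G p q e1 f2 f3"
      "\<And>g. g \<in> A \<Longrightarrow> \<exists>x s. g = point G e1 f2 f3 x s 0" "point G e1 f2 f3 x1 1 0 \<in> A"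
  | (two) f2 f3 y z where "pqq_frame G p q e1 f2 f3"
      "point G e1 f2 f3 y 1 0 \<in> A" "point G e1 f2 f3 z 0 1 \<in> A"
proof (cases "\<exists>x a b y c d. pt x a b \<in> A \<and> pt y c d \<in> A \<and> \<not> int q dvd a * d - b * c")
  case True
  then obtain x a b y c d where "pt x a b \<in> A" "pt y c d \<in> A" "\<not> int q dvd a * d - b * c" by blast
  then show ?thesis
    using two[OF frame_change, of a d b c x y] by (simp add: point_frame_change)
next
  case False
  show ?thesis
  proof (cases "\<exists>x a b. pt x a b \<in> A \<and> \<not> (int q dvd a \<and> int q dvd b)")
    case True
    then obtain x a b where ab: "pt x a b \<in> A" "\<not> (int q dvd a \<and> int q dvd b)" by blast
    define c d :: int where "c = (if int q dvd a then 1 else 0)" and "d = (if int q dvd a then 0 else 1)"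
    have det: "\<not> int q dvd a * d - b * c" using ab(2) by (auto simp: c_def d_def)
    interpret F: pqq_frame G p q e1 "pt 0 a b" "pt 0 c d" by (rule frame_change[OF det])
    have "\<exists>y s. g = F.pt y s 0" if g: "g \<in> A" for g
    proof -
      obtain y s t where y: "g = F.pt y s t" using F.point_surj g A by blast
      then have "pt y (s * a + t * c) (s * b + t * d) \<in> A" using g by (simp add: point_frame_change)
      then have "int q dvd a * (s * b + t * d) - b * (s * a + t * c)" using False ab(1) by blast
      moreover have "a * (s * b + t * d) - b * (s * a + t * c) = t * (a * d - b * c)" by algebra
      ultimately have "int q dvd t * (a * d - b * c)" by metis
      then have "int q dvd t" by (rule prime_dvd_cancel[OF prime_q _ det])
      then have "g = F.pt y s 0" unfolding y F.point_eq_iff by (simp add: cong_0_iff)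
      then show ?thesis by blast
    qed
    then show ?thesis using one[OF frame_change[OF det], of x] ab(1) by (simp add: point_frame_change)
  next
    case nF: False
    have "\<exists>x. g = pt x 0 0" if g: "g \<in> A" for g
    proof -
      obtain y s t where y: "g = pt y s t" using point_surj g A by blast
      then have "g = pt y 0 0" using nF g point_eq_iff by (simp add: cong_0_iff)
      then show ?thesis by blast
    qed
    then show ?thesis using zero by blast
  qed
qed

text \<open>
  The kernel of a nonzero linear form on one of the two components is a proper subgroup, so a generating
  set is not contained in it.
\<close>
lemma generating_leaves_subgroup:
  assumes gen: "generate G A = carrier G" and A: "A \<subseteq> carrier G"
  shows generating_P: "\<exists>x s t. pt x s t \<in> A \<and> \<not> int p dvd x"
    and generating_Q: "\<not> (int q dvd u \<and> int q dvd v) \<Longrightarrow>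
      \<exists>x s t. pt x s t \<in> A \<and> \<not> int q dvd u * t - v * s"
proof -
  show "\<exists>x s t. pt x s t \<in> A \<and> \<not> int p dvd x"
  proof (rule ccontr)
    assume n: "\<not> ?thesis"
    let ?H = "{pt x s t | x s t. int p dvd x}"
    have "subgroup ?H G"
    proof (rule subgroupI)
      have "pt 0 0 0 \<in> ?H" by force
      then show "?H \<noteq> {}" by blast
      show "inv a \<in> ?H" if "a \<in> ?H" for a using that point_inv by force
      show "a \<otimes> b \<in> ?H" if "a \<in> ?H" "b \<in> ?H" for a b using that point_mult by (force intro: dvd_add)
    qed auto
    moreover have "A \<subseteq> ?H" using n A point_surj by blast
    ultimately have "pt 1 0 0 \<in> ?H" using generate_subgroup_incl gen point_closed by blast
    then obtain x s t where "pt 1 0 0 = pt x s t" "int p dvd x" by blast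
    then have "int p dvd 1" using point_eq_iff cong_dvd_iff by (metis cong_0_iff cong_trans)
    then show False using prime_p by auto
  qed
  show "\<exists>x s t. pt x s t \<in> A \<and> \<not> int q dvd u * t - v * s" if uv: "\<not> (int q dvd u \<and> int q dvd v)"
  proof (rule ccontr)
    assume n: "\<not> ?thesis"
    let ?H = "{pt x s t | x s t. int q dvd u * t - v * s}"
    have "subgroup ?H G"
    proof (rule subgroupI)
      have "pt 0 0 0 \<in> ?H" by force
      then show "?H \<noteq> {}" by blast
      show "inv a \<in> ?H" if a: "a \<in> ?H" for a
      proof -
        obtain x s t where *: "a = pt x s t" "int q dvd u * t - v * s" using a by blast
        then have "int q dvd - (u * t - v * s)" by (simp only: dvd_minus_iff)
        moreover have "- (u * t - v * s) = u * (- t) - v * (- s)" by algebra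
        ultimately have "int q dvd u * (- t) - v * (- s)" by metis
        then show ?thesis using * point_inv by blast
      qed
      show "a \<otimes> b \<in> ?H" if ab: "a \<in> ?H" "b \<in> ?H" for a b
      proof -
        obtain x s t x' s' t' where *: "a = pt x s t" "int q dvd u * t - v * s"
          "b = pt x' s' t'" "int q dvd u * t' - v * s'" using ab by blast
        then have "int q dvd (u * t - v * s) + (u * t' - v * s')" by (intro dvd_add)
        moreover have "(u * t - v * s) + (u * t' - v * s') = u * (t + t') - v * (s + s')" by algebra
        ultimately have "int q dvd u * (t + t') - v * (s + s')" by metis
        then show ?thesis using * point_mult by blast
      qed
    qed auto
    moreover have "A \<subseteq> ?H" using n A point_surj by blast
    ultimately have H: "carrier G \<subseteq> ?H" using generate_subgroup_incl gen by blast
    have "int q dvd u * t - v * s" for s t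
    proof -
      obtain x s' t' where *: "pt 0 s t = pt x s' t'" "int q dvd u * t' - v * s'" using H point_closed by blast
      then have "[u * t - v * s = u * t' - v * s'] (mod int q)"
        by (intro cong_diff cong_scalar_left) (auto simp: point_eq_iff)
      then show ?thesis using *(2) cong_dvd_iff by (metis cong_0_iff cong_trans)
    qed
    from this[of 1 0] this[of 0 1] show False using uv by simp
  qed
qed

end

section \<open>The seven families in coordinates\<close>

text \<open>
  The seven families of pairs \<open>(S\<^sub>0, C)\<close>, for an arbitrary coordinate map \<open>f\<close>. The names describe the two
  factors, where an axis is a copy of \<open>\<int>\<^sub>p\<close>, lines and planes lie over \<open>\<int>\<^sub>q\<close>, and a cylinder is a union of
  cosets of the first axis.
\<close>
inductive canonical_pair :: "(int \<Rightarrow> int \<Rightarrow> int \<Rightarrow> 'a) \<Rightarrow> nat \<Rightarrow> nat \<Rightarrow> 'a set \<Rightarrow> 'a set \<Rightarrow> bool"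
  for f :: "int \<Rightarrow> int \<Rightarrow> int \<Rightarrow> 'a" and p q :: nat
where
  transversal_plane: "\<lbrakk>\<alpha> 0 = 0; \<beta> 0 = 0;
    A = {f (int i) (\<alpha> i) (\<beta> i) | i. i < p};
    C = {f 0 (int i) (int j) | i j. i < q \<and> j < q}\<rbrakk> \<Longrightarrow> canonical_pair f p q A C"
| triple_cylinder: "\<lbrakk>q = 3; \<alpha> 0 = 0;
    A = {f (\<alpha> i) (\<alpha> i) (int i) | i. i < q};
    C = {f (int i) (int j) 0 | i j. i < p \<and> j < q}\<rbrakk> \<Longrightarrow> canonical_pair f p q A C"
| cylinder_skew_line: "\<lbrakk>q = 3; \<alpha> 0 = 0; \<kappa> 0 = 0;
    A = {f (int j) (\<alpha> i) (int i) | i j. i < q \<and> j < p};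
    C = {f (\<kappa> i) (int i) 0 | i. i < q}\<rbrakk> \<Longrightarrow> canonical_pair f p q A C"
| cosets_transversal: "\<lbrakk>\<alpha> 0 = 0; \<kappa> 0 = 0;
    A = {f (int i) (int j) (\<alpha> i) | i j. i < p \<and> j < q};
    C = {f 0 (\<kappa> i) (int i) | i. i < q}\<rbrakk> \<Longrightarrow> canonical_pair f p q A C"
| graph_line: "\<lbrakk>\<gamma> 0 0 = 0;
    A = {f (int i) (\<gamma> i j) (int j) | i j. i < p \<and> j < q};
    C = {f 0 (int i) 0 | i. i < q}\<rbrakk> \<Longrightarrow> canonical_pair f p q A C"
| periodic_graph: "\<lbrakk>\<alpha> 0 = 0; \<kappa> 0 = 0;
    A = {f (\<alpha> i) (int j) (int i) | i j. i < q \<and> j < q};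
    C = {f (int i) (\<kappa> i) 0 | i. i < p}\<rbrakk> \<Longrightarrow> canonical_pair f p q A C"
| graph_axis: "\<lbrakk>\<gamma> 0 0 = 0;
    A = {f (\<gamma> i j) (int i) (int j) | i j. i < q \<and> j < q};
    C = {f (int i) 0 0 | i. i < p}\<rbrakk> \<Longrightarrow> canonical_pair f p q A C"
  for \<alpha> \<beta> \<kappa> :: "nat \<Rightarrow> int" and \<gamma> :: "nat \<Rightarrow> nat \<Rightarrow> int"

lemma card_family_le: "card {h i | i. i < n} \<le> n" for h :: "nat \<Rightarrow> 'a"
proof -
  have "{h i | i. i < n} = h ` {..<n}" by auto
  then show ?thesis using card_image_le[of "{..<n}" h] by simp
qed

lemma card_double_family_le: "card {h i j | i j. i < m \<and> j < n} \<le> m * n" for h :: "nat \<Rightarrow> nat \<Rightarrow> 'a"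
proof -
  have "{h i j | i j. i < m \<and> j < n} = (\<lambda>(i, j). h i j) ` ({..<m} \<times> {..<n})" by auto
  then show ?thesis using card_image_le[of "{..<m} \<times> {..<n}" "\<lambda>(i, j). h i j"] by simp
qed

lemma periodic_shift:
  fixes P :: "int \<Rightarrow> bool" and r :: nat
  assumes "r > 0" "\<And>a b. P a \<Longrightarrow> [a = b] (mod int r) \<Longrightarrow> P b" "\<And>a. P a \<Longrightarrow> P (a + 1)" "P a"
  shows "P b"
proof -
  have "P (a + int n)" for n
  proof (induction n)
    case (Suc n)
    have "a + int (Suc n) = a + int n + 1" by simp
    then show ?case using assms(3)[OF Suc] by metis
  qed (use assms(4) in simp)
  moreover have "[a + int (nat ((b - a) mod int r)) = b] (mod int r)"
    using assms(1) by (simp add: cong_def mod_add_right_eq)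
  ultimately show ?thesis using assms(2) by blast
qed

context pqq_frame
begin

lemma q_neq_1: "q \<noteq> Suc 0"
  using prime_q by auto

lemma factorizationI_point:
  assumes "A \<subseteq> carrier G" "B \<subseteq> carrier G" "card A \<le> m" "card B \<le> n" "m * n = p * (q * q)"
    and "\<And>x s t. \<exists>a\<in>A. \<exists>b\<in>B. pt x s t = a \<otimes> b"
  shows "factorization G A B"
proof (rule factorizationI_card[OF finite_carrier assms(1,2)])
  show "\<exists>a\<in>A. \<exists>b\<in>B. g = a \<otimes> b" if "g \<in> carrier G" for g
    using point_surj[OF that] assms(6) by blast
  show "card A * card B \<le> card (carrier G)"
    using mult_le_mono[OF assms(3,4)] assms(5) card_carrier by simp
qed

text \<open>
  Each family is solved coordinate by coordinate, starting with a coordinate to which only the first factor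
  contributes; the index sets have the right size for the counting criterion.
\<close>
lemma canonical_pair_factorization:
  assumes "canonical_pair pt p q A C"
  shows "factorization G A C"
  using assms
proof cases
  case (transversal_plane \<alpha> \<beta>)
  show ?thesis
  proof (rule factorizationI_point)
    fix x s t
    obtain i where i: "i < p" "[x = int i] (mod int p)" using residue_representative[OF p_pos] .
    obtain j where j: "j < q" "[s - \<alpha> i = int j] (mod int q)" using residue_representative[OF q_pos] .
    obtain k where k: "k < q" "[t - \<beta> i = int k] (mod int q)" using residue_representative[OF q_pos] .
    have "pt x s t = pt (int i) (\<alpha> i) (\<beta> i) \<otimes> pt 0 (int j) (int k)"
      using i j k by (simp add: point_mult point_eq_iff cong_iff_dvd_diff algebra_simps)
    then show "\<exists>a\<in>A. \<exists>b\<in>C. pt x s t = a \<otimes> b" unfolding transversal_plane using i j k by blast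
  qed (auto simp only: transversal_plane point_closed card_family_le card_double_family_le)
next
  case (triple_cylinder \<alpha>)
  show ?thesis
  proof (rule factorizationI_point[where m = q and n = "p * q"])
    fix x s t
    obtain i where i: "i < q" "[t = int i] (mod int q)" using residue_representative[OF q_pos] .
    obtain j where j: "j < p" "[x - \<alpha> i = int j] (mod int p)" using residue_representative[OF p_pos] .
    obtain k where k: "k < q" "[s - \<alpha> i = int k] (mod int q)" using residue_representative[OF q_pos] .
    have "pt x s t = pt (\<alpha> i) (\<alpha> i) (int i) \<otimes> pt (int j) (int k) 0"
      using i j k by (simp add: point_mult point_eq_iff cong_iff_dvd_diff algebra_simps)
    then show "\<exists>a\<in>A. \<exists>b\<in>C. pt x s t = a \<otimes> b" unfolding triple_cylinder(3,4) using i j k by blast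
    show "card A \<le> q" unfolding triple_cylinder(3) by (rule card_family_le)
    show "card C \<le> p * q" unfolding triple_cylinder(4) by (rule card_double_family_le)
  qed (use triple_cylinder(3,4) in auto)
next
  case (cylinder_skew_line \<alpha> \<kappa>)
  show ?thesis
  proof (rule factorizationI_point[where m = "q * p" and n = "q"])
    fix x s t
    obtain i where i: "i < q" "[t = int i] (mod int q)" using residue_representative[OF q_pos] .
    obtain k where k: "k < q" "[s - \<alpha> i = int k] (mod int q)" using residue_representative[OF q_pos] .
    obtain j where j: "j < p" "[x - \<kappa> k = int j] (mod int p)" using residue_representative[OF p_pos] .
    have "pt x s t = pt (int j) (\<alpha> i) (int i) \<otimes> pt (\<kappa> k) (int k) 0"
      using i j k by (simp add: point_mult point_eq_iff cong_iff_dvd_diff algebra_simps)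
    then show "\<exists>a\<in>A. \<exists>b\<in>C. pt x s t = a \<otimes> b" unfolding cylinder_skew_line(4,5) using i j k by blast
    show "card A \<le> q * p" unfolding cylinder_skew_line(4) by (rule card_double_family_le)
    show "card C \<le> q" unfolding cylinder_skew_line(5) by (rule card_family_le)
  qed (use cylinder_skew_line(4,5) in auto)
next
  case (cosets_transversal \<alpha> \<kappa>)
  show ?thesis
  proof (rule factorizationI_point[where m = "p * q" and n = "q"])
    fix x s t
    obtain i where i: "i < p" "[x = int i] (mod int p)" using residue_representative[OF p_pos] .
    obtain k where k: "k < q" "[t - \<alpha> i = int k] (mod int q)" using residue_representative[OF q_pos] .
    obtain j where j: "j < q" "[s - \<kappa> k = int j] (mod int q)" using residue_representative[OF q_pos] .
    have "pt x s t = pt (int i) (int j) (\<alpha> i) \<otimes> pt 0 (\<kappa> k) (int k)"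
      using i j k by (simp add: point_mult point_eq_iff cong_iff_dvd_diff algebra_simps)
    then show "\<exists>a\<in>A. \<exists>b\<in>C. pt x s t = a \<otimes> b" unfolding cosets_transversal using i j k by blast
    show "card A \<le> p * q" unfolding cosets_transversal(3) by (rule card_double_family_le)
    show "card C \<le> q" unfolding cosets_transversal(4) by (rule card_family_le)
  qed (use cosets_transversal(3,4) in auto)
next
  case (graph_line \<gamma>)
  show ?thesis
  proof (rule factorizationI_point[where m = "p * q" and n = "q"])
    fix x s t
    obtain i where i: "i < p" "[x = int i] (mod int p)" using residue_representative[OF p_pos] .
    obtain j where j: "j < q" "[t = int j] (mod int q)" using residue_representative[OF q_pos] .
    obtain k where k: "k < q" "[s - \<gamma> i j = int k] (mod int q)" using residue_representative[OF q_pos] .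
    have "pt x s t = pt (int i) (\<gamma> i j) (int j) \<otimes> pt 0 (int k) 0"
      using i j k by (simp add: point_mult point_eq_iff cong_iff_dvd_diff algebra_simps)
    then show "\<exists>a\<in>A. \<exists>b\<in>C. pt x s t = a \<otimes> b" unfolding graph_line using i j k by blast
    show "card A \<le> p * q" unfolding graph_line(2) by (rule card_double_family_le)
    show "card C \<le> q" unfolding graph_line(3) by (rule card_family_le)
  qed (use graph_line(2,3) in auto)
next
  case (periodic_graph \<alpha> \<kappa>)
  show ?thesis
  proof (rule factorizationI_point[where m = "q * q" and n = "p"])
    fix x s t
    obtain i where i: "i < q" "[t = int i] (mod int q)" using residue_representative[OF q_pos] .
    obtain k where k: "k < p" "[x - \<alpha> i = int k] (mod int p)" using residue_representative[OF p_pos] .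
    obtain j where j: "j < q" "[s - \<kappa> k = int j] (mod int q)" using residue_representative[OF q_pos] .
    have "pt x s t = pt (\<alpha> i) (int j) (int i) \<otimes> pt (int k) (\<kappa> k) 0"
      using i j k by (simp add: point_mult point_eq_iff cong_iff_dvd_diff algebra_simps)
    then show "\<exists>a\<in>A. \<exists>b\<in>C. pt x s t = a \<otimes> b" unfolding periodic_graph using i j k by blast
    show "card A \<le> q * q" unfolding periodic_graph(3) by (rule card_double_family_le)
    show "card C \<le> p" unfolding periodic_graph(4) by (rule card_family_le)
  qed (use periodic_graph(3,4) in auto)
next
  case (graph_axis \<gamma>)
  show ?thesis
  proof (rule factorizationI_point[where m = "q * q" and n = "p"])
    fix x s t
    obtain i where i: "i < q" "[s = int i] (mod int q)" using residue_representative[OF q_pos] .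
    obtain j where j: "j < q" "[t = int j] (mod int q)" using residue_representative[OF q_pos] .
    obtain k where k: "k < p" "[x - \<gamma> i j = int k] (mod int p)" using residue_representative[OF p_pos] .
    have "pt x s t = pt (\<gamma> i j) (int i) (int j) \<otimes> pt (int k) 0 0"
      using i j k by (simp add: point_mult point_eq_iff cong_iff_dvd_diff algebra_simps)
    then show "\<exists>a\<in>A. \<exists>b\<in>C. pt x s t = a \<otimes> b" unfolding graph_axis using i j k by blast
    show "card A \<le> q * q" unfolding graph_axis(2) by (rule card_double_family_le)
    show "card C \<le> p" unfolding graph_axis(3) by (rule card_family_le)
  qed (use graph_axis(2,3) in auto)
qed

section \<open>A factor of order p\<close>

context
  fixes A B
  assumes fac: "factorization G A B" and cards: "card A = p" "card B = q * q"
    and one_mem: "\<one> \<in> A" "\<one> \<in> B"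
begin

text \<open>
  Projecting \<open>B\<close> onto the plane (multiplier \<open>0\<close> on \<open>\<int>\<^sub>p\<close>), or \<open>A\<close> onto the first axis, shows that \<open>A\<close> is
  a graph over the axis and \<open>B\<close> a graph over the plane. Uniqueness for one factor uses coverage by
  the other.
\<close>
lemma P_cover_A: "\<exists>s t. pt x s t \<in> A"
proof -
  have "q dvd card B \<Longrightarrow> \<not> int q dvd 1" "p dvd card B \<Longrightarrow> \<not> int p dvd 0"
    using prime_q not_p_dvd_qq cards by auto
  from scaled_cover[OF factorization_commute[OF fac] this(2,1), of x 0 0] show ?thesis by fastforce
qed

lemma P_cover_B: "\<exists>x. pt x s t \<in> B"
proof -
  have "q dvd card A \<Longrightarrow> \<not> int q dvd 0" "p dvd card A \<Longrightarrow> \<not> int p dvd 1"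
    using prime_p not_p_dvd_q cards by auto
  from scaled_cover[OF fac this(2,1), of _ s t] show ?thesis by auto
qed

lemma P_unique_B:
  assumes "pt x s t \<in> B" "pt x' s' t' \<in> B" "[s = s'] (mod int q)" "[t = t'] (mod int q)"
  shows "[x = x'] (mod int p)"
proof -
  obtain s1 t1 where a: "pt (x - x') s1 t1 \<in> A" using P_cover_A by blast
  have z: "pt 0 0 0 \<in> A" using one_mem point_zero by simp
  have "q dvd card A \<Longrightarrow> \<not> int q dvd 0" "p dvd card A \<Longrightarrow> \<not> int p dvd 1"
    using prime_p not_p_dvd_q cards by auto
  from scaled_unique[OF fac this(2,1) z a assms(1,2)] assms(3,4)
  show ?thesis by (auto simp: point_eq_iff)
qed

lemma P_unique_A:
  assumes "pt x s t \<in> A" "pt x' s' t' \<in> A" "[x = x'] (mod int p)"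
  shows "[s = s'] (mod int q) \<and> [t = t'] (mod int q)"
proof -
  obtain x1 where b: "pt x1 (s - s') (t - t') \<in> B" using P_cover_B by blast
  have z: "pt 0 0 0 \<in> B" using one_mem point_zero by simp
  have "q dvd card B \<Longrightarrow> \<not> int q dvd 1" "p dvd card B \<Longrightarrow> \<not> int p dvd 0"
    using prime_q not_p_dvd_qq cards by auto
  from scaled_unique[OF factorization_commute[OF fac] this(2,1) z b assms(1,2)] assms(3)
  show ?thesis by (auto simp: point_eq_iff)
qed

text \<open>
  Let \<open>x'\<close> be the first coordinate of \<open>B\<close> above the translated point. If it differed from \<open>x\<close>, some
  nonzero multiplier \<open>m\<close> would carry \<open>x1\<close> to \<open>x' - x\<close>, giving two factorizations of one element.
\<close>
lemma P_translate:
  assumes a: "pt x1 s1 t1 \<in> A" and b: "pt x s t \<in> B"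
  shows "pt x (s + s1) (t + t1) \<in> B"
proof -
  have z: "pt 0 0 0 \<in> A" using one_mem point_zero by simp
  obtain x' where b': "pt x' (s + s1) (t + t1) \<in> B" using P_cover_B by blast
  show ?thesis
  proof (cases "int p dvd x1")
    case True
    then have "[s1 = 0] (mod int q)" "[t1 = 0] (mod int q)"
      using P_unique_A[OF a z] by (auto simp: cong_0_iff)
    then show ?thesis using point_in_cong[OF b] by (simp add: cong_iff_dvd_diff)
  next
    case False
    obtain m where m: "[m * x1 = x' - x] (mod int p)" using cong_solve_prime[OF prime_p False] by blast
    have "int p dvd m"
    proof (rule ccontr)
      assume nm: "\<not> int p dvd m"
      have "q dvd card A \<Longrightarrow> \<not> int q dvd 1" using not_p_dvd_q cards by auto
      from scaled_unique[OF fac nm this a z b b'] m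
      have "pt x1 s1 t1 = pt 0 0 0" by (simp add: cong_iff_dvd_diff algebra_simps)
      then show False using False by (simp add: point_eq_iff cong_0_iff)
    qed
    then have "[x' = x] (mod int p)"
      using m by (metis cong_0_iff cong_diff_iff_cong_0 cong_sym cong_trans dvd_mult2)
    then show ?thesis using point_in_cong[OF b'] by simp
  qed
qed

end

text \<open>
  Since \<open>A\<close> generates, its plane components span the plane; being invariant under all these
  translations, the graph \<open>B\<close> is constant.
\<close>
theorem generating_factor_of_order_p:
  assumes fac: "factorization G A B" and cards: "card A = p" "card B = q * q"
    and one_mem: "\<one> \<in> A" "\<one> \<in> B" and gen: "generate G A = carrier G"
  shows "\<exists>f2 f3. pqq_frame G p q e1 f2 f3 \<and> canonical_pair (point G e1 f2 f3) p q A B"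
proof -
  have sub: "A \<subseteq> carrier G" "B \<subseteq> carrier G" using fac unfolding factorization_def by auto
  from sub(1) show ?thesis
  proof (cases rule: dimension_cases)
    case zero
    obtain x s t where "pt x s t \<in> A" "\<not> int q dvd 1 * t - 0 * s"
      using generating_Q[OF gen sub(1), of 1 0] q_neq_1 by auto
    with zero show ?thesis by (metis cong_0_iff diff_zero mult_1 mult_zero_left point_eq_iff)
  next
    case (one f2 f3 x1)
    interpret F: pqq_frame G p q e1 f2 f3 by (rule one(1))
    obtain x s t where "F.pt x s t \<in> A" "\<not> int q dvd 1 * t - 0 * s"
      using F.generating_Q[OF gen sub(1), of 1 0] q_neq_1 by auto
    with one(2) show ?thesis by (metis cong_0_iff diff_zero mult_1 mult_zero_left F.point_eq_iff)
  next
    case (two f2 f3 y z)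
    interpret F: pqq_frame G p q e1 f2 f3 by (rule two(1))
    note L = fac cards one_mem
    have z: "F.pt 0 0 0 \<in> A" "F.pt 0 0 0 \<in> B" using one_mem F.point_zero by auto
    have shift2: "F.pt x s' t \<in> B" if "F.pt x s t \<in> B" for x s s' t
    proof (rule periodic_shift[OF q_pos, where P = "\<lambda>s. F.pt x s t \<in> B" and a = s])
      show "F.pt x (a + 1) t \<in> B" if "F.pt x a t \<in> B" for a
        using F.P_translate[OF L two(2) that] by simp
    qed (use that F.point_in_cong in auto)
    have shift3: "F.pt x s t' \<in> B" if "F.pt x s t \<in> B" for x s t' t
    proof (rule periodic_shift[OF q_pos, where P = "\<lambda>t. F.pt x s t \<in> B" and a = t])
      show "F.pt x s (a + 1) \<in> B" if "F.pt x s a \<in> B" for a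
        using F.P_translate[OF L two(3) that] by simp
    qed (use that F.point_in_cong in auto)
    have plane: "F.pt 0 s t \<in> B" for s t using z(2) shift2 shift3 by blast
    have B: "B = {F.pt 0 (int i) (int j) | i j. i < q \<and> j < q}"
    proof (intro subset_antisym subsetI)
      fix g assume g: "g \<in> B"
      then obtain x s t where x: "g = F.pt x s t" using F.point_surj sub by blast
      obtain i where i: "i < q" "[s = int i] (mod int q)" using residue_representative[OF q_pos] .
      obtain j where j: "j < q" "[t = int j] (mod int q)" using residue_representative[OF q_pos] .
      have "[x = 0] (mod int p)" using F.P_unique_B[OF L, of x s t 0 s t] g x plane by simp
      then have "g = F.pt 0 (int i) (int j)" using x i j by (simp add: F.point_eq_iff)
      then show "g \<in> {F.pt 0 (int i) (int j) | i j. i < q \<and> j < q}" using i j by blast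
    qed (use plane in auto)
    have "\<forall>i. \<exists>s t. F.pt (int i) s t \<in> A \<and> (i = 0 \<longrightarrow> s = 0 \<and> t = 0)"
      using F.P_cover_A[OF L] z(1) by (metis of_nat_0)
    then obtain \<alpha> \<beta> where ab: "\<And>i. F.pt (int i) (\<alpha> i) (\<beta> i) \<in> A" "\<alpha> 0 = 0" "\<beta> 0 = 0" by metis
    have A: "A = {F.pt (int i) (\<alpha> i) (\<beta> i) | i. i < p}"
    proof (intro subset_antisym subsetI)
      fix g assume g: "g \<in> A"
      then obtain x s t where x: "g = F.pt x s t" using F.point_surj sub by blast
      obtain i where i: "i < p" "[x = int i] (mod int p)" using residue_representative[OF p_pos] .
      have "g = F.pt (int i) (\<alpha> i) (\<beta> i)"
        using F.P_unique_A[OF L, of x s t "int i" "\<alpha> i" "\<beta> i"] g x i ab by (simp add: F.point_eq_iff)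
      then show "g \<in> {F.pt (int i) (\<alpha> i) (\<beta> i) | i. i < p}" using i by blast
    qed (use ab in auto)
    show ?thesis using canonical_pair.transversal_plane[OF ab(2,3) A B] two(1) by blast
  qed
qed

text \<open>
  Here the generating factor \<open>A\<close> is a graph over the plane, periodic along the span of the plane
  components of \<open>C\<close>. A span of dimension two would make \<open>A\<close> the plane itself.
\<close>
theorem complement_of_factor_of_order_p:
  assumes fac: "factorization G C A" and cards: "card C = p" "card A = q * q"
    and one_mem: "\<one> \<in> C" "\<one> \<in> A" and gen: "generate G A = carrier G"
  shows "\<exists>f2 f3. pqq_frame G p q e1 f2 f3 \<and> canonical_pair (point G e1 f2 f3) p q A C"
proof -
  have sub: "C \<subseteq> carrier G" "A \<subseteq> carrier G" using fac unfolding factorization_def by auto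
  note L = fac cards one_mem
  from sub(1) show ?thesis
  proof (cases rule: dimension_cases)
    case zero
    have z: "pt 0 0 0 \<in> A" using one_mem point_zero by auto
    have axis: "pt x 0 0 \<in> C" for x
    proof -
      obtain s t where st: "pt x s t \<in> C" using P_cover_A[OF L] by blast
      then obtain x' where "pt x s t = pt x' 0 0" using zero by blast
      then show ?thesis using st by (intro point_in_cong[OF st]) (auto simp: point_eq_iff)
    qed
    have C: "C = {pt (int i) 0 0 | i. i < p}"
    proof (intro subset_antisym subsetI)
      fix g assume "g \<in> C"
      then obtain x where x: "g = pt x 0 0" using zero by blast
      obtain i where i: "i < p" "[x = int i] (mod int p)" using residue_representative[OF p_pos] .
      then have "g = pt (int i) 0 0" using x by (simp add: point_eq_iff)
      then show "g \<in> {pt (int i) 0 0 | i. i < p}" using i by blast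
    qed (use axis in auto)
    have "\<forall>i j. \<exists>x. pt x (int i) (int j) \<in> A \<and> (i = 0 \<and> j = 0 \<longrightarrow> x = 0)"
      using P_cover_B[OF L] z by (metis of_nat_0)
    then obtain \<gamma> where c: "\<And>i j. pt (\<gamma> i j) (int i) (int j) \<in> A" "\<gamma> 0 0 = 0" by metis
    have A: "A = {pt (\<gamma> i j) (int i) (int j) | i j. i < q \<and> j < q}"
    proof (intro subset_antisym subsetI)
      fix g assume g: "g \<in> A"
      then obtain x s t where x: "g = pt x s t" using point_surj sub by blast
      obtain i where i: "i < q" "[s = int i] (mod int q)" using residue_representative[OF q_pos] .
      obtain j where j: "j < q" "[t = int j] (mod int q)" using residue_representative[OF q_pos] .
      have "g = pt (\<gamma> i j) (int i) (int j)"
        using P_unique_B[OF L, of x s t "\<gamma> i j" "int i" "int j"] g x i j c by (simp add: point_eq_iff)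
      then show "g \<in> {pt (\<gamma> i j) (int i) (int j) | i j. i < q \<and> j < q}" using i j by blast
    qed (use c in auto)
    show ?thesis using canonical_pair.graph_axis[OF c(2) A C] pqq_frame_axioms by blast
  next
    case (one f2 f3 x1)
    interpret F: pqq_frame G p q e1 f2 f3 by (rule one(1))
    have z: "F.pt 0 0 0 \<in> A" "F.pt 0 0 0 \<in> C" using one_mem F.point_zero by auto
    have shift: "F.pt x s' t \<in> A" if "F.pt x s t \<in> A" for x s s' t
    proof (rule periodic_shift[OF q_pos, where P = "\<lambda>s. F.pt x s t \<in> A" and a = s])
      show "F.pt x (a + 1) t \<in> A" if "F.pt x a t \<in> A" for a
        using F.P_translate[OF L one(3) that] by simp
    qed (use that F.point_in_cong in auto)
    have "\<exists>s. F.pt x s 0 \<in> C" for x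
    proof -
      obtain s t where st: "F.pt x s t \<in> C" using F.P_cover_A[OF L] by blast
      then obtain x' s' where "F.pt x s t = F.pt x' s' 0" using one(2) by blast
      then have "F.pt x s 0 \<in> C" using st by (intro F.point_in_cong[OF st]) (auto simp: F.point_eq_iff)
      then show ?thesis by blast
    qed
    then have "\<forall>i. \<exists>s. F.pt (int i) s 0 \<in> C \<and> (i = 0 \<longrightarrow> s = 0)" using z(2) by (metis of_nat_0)
    then obtain \<kappa> where k: "\<And>i. F.pt (int i) (\<kappa> i) 0 \<in> C" "\<kappa> 0 = 0" by metis
    have C: "C = {F.pt (int i) (\<kappa> i) 0 | i. i < p}"
    proof (intro subset_antisym subsetI)
      fix g assume g: "g \<in> C"
      then obtain x s t where x: "g = F.pt x s t" using F.point_surj sub by blast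
      obtain i where i: "i < p" "[x = int i] (mod int p)" using residue_representative[OF p_pos] .
      have "g = F.pt (int i) (\<kappa> i) 0"
        using F.P_unique_A[OF L, of x s t "int i" "\<kappa> i" 0] g x i k by (simp add: F.point_eq_iff)
      then show "g \<in> {F.pt (int i) (\<kappa> i) 0 | i. i < p}" using i by blast
    qed (use k in auto)
    have "\<forall>i. \<exists>x. F.pt x 0 (int i) \<in> A \<and> (i = 0 \<longrightarrow> x = 0)"
      using F.P_cover_B[OF L] z(1) by (metis of_nat_0)
    then obtain \<alpha> where a: "\<And>i. F.pt (\<alpha> i) 0 (int i) \<in> A" "\<alpha> 0 = 0" by metis
    have A: "A = {F.pt (\<alpha> i) (int j) (int i) | i j. i < q \<and> j < q}"
    proof (intro subset_antisym subsetI)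
      fix g assume g: "g \<in> A"
      then obtain x s t where x: "g = F.pt x s t" using F.point_surj sub by blast
      obtain j where j: "j < q" "[s = int j] (mod int q)" using residue_representative[OF q_pos] .
      obtain i where i: "i < q" "[t = int i] (mod int q)" using residue_representative[OF q_pos] .
      have "F.pt (\<alpha> i) (int j) (int i) \<in> A" using a shift by blast
      then have "g = F.pt (\<alpha> i) (int j) (int i)"
        using F.P_unique_B[OF L, of x s t "\<alpha> i" "int j" "int i"] g x i j by (simp add: F.point_eq_iff)
      then show "g \<in> {F.pt (\<alpha> i) (int j) (int i) | i j. i < q \<and> j < q}" using i j by blast
    qed (auto intro: shift[OF a(1)])
    show ?thesis using canonical_pair.periodic_graph[OF a(2) k(2) A C] one(1) by blast
  next
    case (two f2 f3 y z)
    interpret F: pqq_frame G p q e1 f2 f3 by (rule two(1))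
    have z: "F.pt 0 0 0 \<in> A" using one_mem F.point_zero by auto
    have shift2: "F.pt x s' t \<in> A" if "F.pt x s t \<in> A" for x s s' t
    proof (rule periodic_shift[OF q_pos, where P = "\<lambda>s. F.pt x s t \<in> A" and a = s])
      show "F.pt x (a + 1) t \<in> A" if "F.pt x a t \<in> A" for a
        using F.P_translate[OF L two(2) that] by simp
    qed (use that F.point_in_cong in auto)
    have shift3: "F.pt x s t' \<in> A" if "F.pt x s t \<in> A" for x s t' t
    proof (rule periodic_shift[OF q_pos, where P = "\<lambda>t. F.pt x s t \<in> A" and a = t])
      show "F.pt x s (a + 1) \<in> A" if "F.pt x s a \<in> A" for a
        using F.P_translate[OF L two(3) that] by simp
    qed (use that F.point_in_cong in auto)
    obtain x s t where x: "F.pt x s t \<in> A" "\<not> int p dvd x" using F.generating_P[OF gen sub(2)] by blast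
    have "F.pt 0 s t \<in> A" using z shift2 shift3 by blast
    then have "[x = 0] (mod int p)" using F.P_unique_B[OF L x(1)] by simp
    then show ?thesis using x(2) by (simp add: cong_0_iff)
  qed
qed

end

section \<open>A factor of order q\<close>

lemma family_of_three: "{f i | i. i < (3 :: nat)} = {f 0, f 1, f 2}"
proof -
  have "{..<3 :: nat} = {0, 1, 2}" by auto
  moreover have "{f i | i. i < (3 :: nat)} = f ` {..<3}" by auto
  ultimately show ?thesis by simp
qed

context pqq_frame
begin

lemma residue_pair: "\<exists>k :: nat. [int k = m] (mod int p) \<and> [int k = l] (mod int q)"
  by (rule scaling_exponent[of 1 m l]) (use prime_p prime_q in auto)

context
  fixes A B
  assumes fac: "factorization G A B" and cards: "card A = q" "card B = p * q"
    and one_mem: "\<one> \<in> A" "\<one> \<in> B"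
begin

lemma Q_cover: "\<exists>x1 s1 t1. pt x1 s1 t1 \<in> A \<and> pt x (s - s1) (t - t1) \<in> B"
proof -
  have "q dvd card A \<Longrightarrow> \<not> int q dvd 1" "p dvd card A \<Longrightarrow> \<not> int p dvd 0"
    using prime_q not_p_dvd_q cards by auto
  from scaled_cover[OF fac this(2,1), of x s t] show ?thesis by simp
qed

text \<open>
  The multiplier on \<open>\<int>\<^sub>p\<close> is completely free, so the congruence in the first coordinate can be solved
  for it unless \<open>x1\<close> and \<open>x1'\<close> agree while \<open>x2\<close> and \<open>x2'\<close> do not.
\<close>
lemma Q_unique:
  assumes mem: "pt x1 s1 t1 \<in> A" "pt x1' s1' t1' \<in> A" "pt x2 s2 t2 \<in> B" "pt x2' s2' t2' \<in> B"
    and l: "\<not> int q dvd l" and eq: "[l * s1 + s2 = l * s1' + s2'] (mod int q)"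
      "[l * t1 + t2 = l * t1' + t2'] (mod int q)"
    and x: "[x2 = x2'] (mod int p) \<or> \<not> [x1 = x1'] (mod int p)"
  shows "pt x1 s1 t1 = pt x1' s1' t1' \<and> pt x2 s2 t2 = pt x2' s2' t2'"
proof -
  have "\<exists>m. [m * x1 + x2 = m * x1' + x2'] (mod int p)"
  proof (cases "[x2 = x2'] (mod int p)")
    case True
    then show ?thesis by (intro exI[of _ 0]) simp
  next
    case False
    then have "\<not> int p dvd x1 - x1'" using x by (simp add: cong_iff_dvd_diff)
    then obtain m where "[m * (x1 - x1') = x2' - x2] (mod int p)" using cong_solve_prime[OF prime_p] by blast
    then show ?thesis by (intro exI[of _ m]) (simp add: cong_iff_dvd_diff algebra_simps)
  qed
  then obtain m where m: "[m * x1 + x2 = m * x1' + x2'] (mod int p)" by blast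
  have "p dvd card A \<Longrightarrow> \<not> int p dvd m" using not_p_dvd_q cards by auto
  from scaled_unique[OF fac this l mem m eq] show ?thesis .
qed

text \<open>
  The plane projection of \<open>A\<close> is injective by \<open>Q_unique\<close>, so its \<open>q\<close> values exhaust the line.
\<close>
lemma Q_line_cover:
  assumes line: "\<And>g. g \<in> A \<Longrightarrow> \<exists>x s. g = pt x s 0"
  shows "\<exists>x. pt x s 0 \<in> A"
proof -
  have z: "pt 0 0 0 \<in> B" using one_mem point_zero by simp
  have "\<exists>j<q. \<exists>x. g = pt x (int j) 0" if "g \<in> A" for g
  proof -
    obtain x s where g: "g = pt x s 0" using line[OF \<open>g \<in> A\<close>] by blast
    obtain j where "j < q" "[s = int j] (mod int q)" using residue_representative[OF q_pos] .
    then show ?thesis using g by (metis point_eq_iff cong_refl)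
  qed
  then obtain r where r: "\<And>g. g \<in> A \<Longrightarrow> r g < q" "\<And>g. g \<in> A \<Longrightarrow> \<exists>x. g = pt x (int (r g)) 0" by metis
  have "inj_on r A"
  proof (rule inj_onI)
    fix g h assume gh: "g \<in> A" "h \<in> A" "r g = r h"
    obtain x x' where x: "g = pt x (int (r g)) 0" "h = pt x' (int (r g)) 0" using r(2) gh by metis
    have mem: "pt x (int (r g)) 0 \<in> A" "pt x' (int (r g)) 0 \<in> A" using gh x by metis+
    have "pt x (int (r g)) 0 = pt x' (int (r g)) 0"
      using Q_unique[OF mem z z, of 1] q_neq_1 by simp
    then show "g = h" using x by simp
  qed
  then have "card (r ` A) = card {..<q}" using cards by (simp add: card_image)
  moreover have "r ` A \<subseteq> {..<q}" using r(1) by blast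
  ultimately have im: "r ` A = {..<q}" using card_subset_eq finite_lessThan by blast
  obtain j where j: "j < q" "[s = int j] (mod int q)" using residue_representative[OF q_pos] .
  then obtain g where g: "g \<in> A" "r g = j" using im by (metis imageE lessThan_iff)
  then obtain x where "g = pt x (int j) 0" using r(2) by metis
  then have "pt x s 0 \<in> A" using g j point_in_cong by (metis cong_refl cong_sym)
  then show ?thesis by blast
qed

end

text \<open>
  The elements \<open>0\<close>, \<open>u\<close>, \<open>v\<close> with independent \<open>u\<close>, \<open>v\<close> already number three. In the basis
  \<open>e\<^sub>2 = u + v\<close>, \<open>e\<^sub>3 = u\<close> of the plane one has \<open>v = e\<^sub>2 - e\<^sub>3 = e\<^sub>2 + 2 e\<^sub>3\<close>; the direction of \<open>e\<^sub>2\<close> is the one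
  that the differences of \<open>0\<close>, \<open>u\<close>, \<open>v\<close> miss.
\<close>
lemma triple_frame:
  assumes fac: "factorization G A B" and cards: "card A = q" and q3: "q \<le> 3"
    and one_mem: "\<one> \<in> A"
    and two: "pt y 1 0 \<in> A" "pt z 0 1 \<in> A"
  obtains f2 f3 where "pqq_frame G p q e1 f2 f3" "q = 3"
    "A = {point G e1 f2 f3 0 0 0, point G e1 f2 f3 y 0 1, point G e1 f2 f3 z 1 2}"
proof -
  let ?T = "{pt 0 0 0, pt y 1 0, pt z 0 1}"
  have n1: "\<not> [1 = 0] (mod int q)" "\<not> [0 = 1] (mod int q)" using q_neq_1 by (auto simp: cong_iff_dvd_diff)
  then have T: "card ?T = 3" by (simp add: point_eq_iff)
  have sub: "?T \<subseteq> A" using two one_mem point_zero by simp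
  have fin: "finite A" using cards q_pos by (metis card.infinite less_irrefl)
  have q: "q = 3" using card_mono[OF fin sub] T cards q3 by simp
  then have A: "A = ?T" using card_subset_eq[OF fin sub] T cards by simp
  have det: "\<not> int q dvd 1 * 0 - 1 * 1" using q by simp
  have "A = {point G e1 (pt 0 1 1) (pt 0 1 0) 0 0 0, point G e1 (pt 0 1 1) (pt 0 1 0) y 0 1,
      point G e1 (pt 0 1 1) (pt 0 1 0) z 1 2}"
  proof -
    have "pt z 0 1 = pt z 3 1" by (simp add: point_eq_iff q cong_def)
    then show ?thesis unfolding A point_frame_change by simp
  qed
  then show ?thesis using that[OF frame_change[OF det] q] by blast
qed

context
  fixes A B y z
  assumes fac: "factorization G A B" and cards: "card A = q" "card B = p * q" and q3: "q = 3"
    and one_mem: "\<one> \<in> B"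
    and A_eq: "A = {pt 0 0 0, pt y 0 1, pt z 1 2}"
begin

lemma triple_mem: "pt 0 0 0 \<in> A" "pt y 0 1 \<in> A" "pt z 1 2 \<in> A" "\<one> \<in> A" "pt 0 0 0 \<in> B"
  using A_eq one_mem point_zero by auto

lemma triple_distinct: "pt y 0 1 \<noteq> pt 0 0 0" "pt z 1 2 \<noteq> pt 0 0 0" "pt z 1 2 \<noteq> pt y 0 1"
  by (simp_all add: point_eq_iff q3 cong_def)

lemmas triple_unique = Q_unique[OF fac cards triple_mem(4) one_mem, where l = 1, simplified]

text \<open>
  The point above \<open>(a + 1, t)\<close> is covered by one of three candidates in the same fibre. Two of them
  differ from the given point by a difference of \<open>A\<close>, which uniqueness excludes.
\<close>
lemma triple_fibre_shift:
  assumes b: "pt x s t \<in> B"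
  shows "pt x s' t \<in> B"
proof (rule periodic_shift[OF q_pos, where P = "\<lambda>s. pt x s t \<in> B" and a = s])
  show "pt x (a + 1) t \<in> B" if b: "pt x a t \<in> B" for a
  proof -
    obtain x1 s1 t1 where c: "pt x1 s1 t1 \<in> A" "pt x (a + 1 - s1) (t - t1) \<in> B"
      using Q_cover[OF fac cards triple_mem(4) one_mem] by blast
    then consider "pt x1 s1 t1 = pt 0 0 0" | "pt x1 s1 t1 = pt y 0 1" | "pt x1 s1 t1 = pt z 1 2"
      using A_eq by blast
    then show ?thesis
    proof cases
      case 1
      then show ?thesis using c(2) by (elim point_in_cong) (auto simp: point_eq_iff cong_iff_dvd_diff dvd_diff_commute)
    next
      case 2
      then have "pt x (a + 1) (t - 1) \<in> B"
        using c(2) by (elim point_in_cong) (auto simp: point_eq_iff cong_iff_dvd_diff dvd_diff_commute)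
      from triple_unique[OF triple_mem(3,1) b this] have "pt z 1 2 = pt 0 0 0"
        using q3 by (simp add: cong_iff_dvd_diff)
      then show ?thesis using triple_distinct by simp
    next
      case 3
      then have "pt x a (t - 2) \<in> B"
        using c(2) by (elim point_in_cong) (auto simp: point_eq_iff cong_iff_dvd_diff dvd_diff_commute)
      from triple_unique[OF triple_mem(2,1) b this] have "pt y 0 1 = pt 0 0 0"
        using q3 by (simp add: cong_iff_dvd_diff)
      then show ?thesis using triple_distinct by simp
    qed
  qed
qed (use b point_in_cong in auto)

lemma mod3_cases:
  obtains "[t = t'] (mod int q)" | "[t' = t + 1] (mod int q)" | "[t = t' + 1] (mod int q)"
proof -
  have "3 dvd t - t' \<or> 3 dvd t' - (t + 1) \<or> 3 dvd t - (t' + 1)" by presburger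
  then show ?thesis using that unfolding q3 cong_iff_dvd_diff by auto
qed

text \<open>
  Two points of \<open>B\<close> with different last coordinates can be shifted along \<open>e\<^sub>2\<close> until their plane
  components differ by that of a nonzero element of \<open>A\<close>. Inside one fibre this contradicts uniqueness,
  and across fibres it does so if that element leaves the plane.
\<close>
lemma triple_fibre:
  assumes b: "pt x s t \<in> B" "pt x' s' t' \<in> B"
    and x: "[x = x'] (mod int p) \<or> \<not> int p dvd y \<or> \<not> int p dvd z"
  shows "[t = t'] (mod int q)"
proof -
  \<comment> \<open>A step by \<open>1\<close> is realised by \<open>(0, 1)\<close>, and backwards by \<open>(1, 2)\<close> because \<open>2 = - 1\<close> modulo \<open>3\<close>.\<close>
  have no_step: False if "pt x s t \<in> B" "pt x' s' t' \<in> B" "[t' = t + 1] (mod int q)"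
      "[x = x'] (mod int p) \<or> \<not> int p dvd y \<or> \<not> int p dvd z" for x s t x' s' t'
  proof (cases "[x = x'] (mod int p) \<or> \<not> int p dvd y")
    case True
    have "[s' = s'] (mod int q)" "pt x s' t \<in> B" using triple_fibre_shift that(1) by auto
    from triple_unique[OF triple_mem(2,1) this(2) that(2)] True that(3) have "pt y 0 1 = pt 0 0 0"
      by (auto simp: cong_0_iff cong_iff_dvd_diff algebra_simps dvd_diff_commute q_neq_1)
    then show False using triple_distinct by simp
  next
    case False
    then have z: "\<not> int p dvd z" using that(4) by simp
    have "pt x' (s - 1) t' \<in> B" using triple_fibre_shift that(2) by blast
    have "3 dvd t' - (t + 1)" using that(3) q3 by (simp add: cong_iff_dvd_diff)
    then have "3 dvd 2 + t' - t" by presburger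
    with triple_unique[OF triple_mem(3,1) \<open>pt x' (s - 1) t' \<in> B\<close> that(1)] z have "pt z 1 2 = pt 0 0 0"
      using q3 by (simp add: cong_0_iff cong_iff_dvd_diff)
    then show False using triple_distinct by simp
  qed
  have x': "[x' = x] (mod int p) \<or> \<not> int p dvd y \<or> \<not> int p dvd z" using x cong_sym by blast
  show ?thesis
    by (rule mod3_cases[of t t']) (use no_step[OF b _ x] no_step[OF b(2,1) _ x'] in blast)+
qed

lemma triple_nonempty: "\<exists>s t. pt x s t \<in> B"
  using Q_cover[OF fac cards triple_mem(4) one_mem] by blast

lemma triple_is_cylinder:
  assumes "\<not> int p dvd y \<or> \<not> int p dvd z"
  shows "B = {pt (int i) (int j) 0 | i j. i < p \<and> j < q}"
proof (intro subset_antisym subsetI)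
  fix g assume g: "g \<in> B"
  then obtain x s t where x: "g = pt x s t" using point_surj factorizationD(2)[OF fac] by blast
  obtain i where i: "i < p" "[x = int i] (mod int p)" using residue_representative[OF p_pos] .
  obtain j where j: "j < q" "[s = int j] (mod int q)" using residue_representative[OF q_pos] .
  have "[t = 0] (mod int q)" using triple_fibre[of x s t 0 0 0] triple_mem(5) g x assms by blast
  then have "g = pt (int i) (int j) 0" using x i j by (simp add: point_eq_iff)
  then show "g \<in> {pt (int i) (int j) 0 | i j. i < p \<and> j < q}" using i j by blast
next
  fix g assume "g \<in> {pt (int i) (int j) 0 | i j. i < p \<and> j < q}"
  then obtain i j where g: "g = pt (int i) (int j) 0" by blast
  obtain s t where st: "pt (int i) s t \<in> B" using triple_nonempty by blast
  then have "[t = 0] (mod int q)" using triple_fibre[of "int i" s t 0 0 0] triple_mem(5) assms by blast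
  then have "pt (int i) s 0 \<in> B" using point_in_cong[OF st] by simp
  then show "g \<in> B" unfolding g by (rule triple_fibre_shift)
qed

end

text \<open>
  A generating factor spans the plane, so it is a triple, and it leaves the plane, so \<open>B\<close> is a product.
  The first two coordinates of a nonzero element of \<open>A\<close> are residues modulo the coprime numbers \<open>p\<close> and
  \<open>3\<close>, which is why a single integer can serve as both.
\<close>
theorem generating_factor_of_order_q:
  assumes fac: "factorization G A B" and cards: "card A = q" "card B = p * q" and q3: "q \<le> 3"
    and one_mem: "\<one> \<in> A" "\<one> \<in> B" and gen: "generate G A = carrier G"
  shows "\<exists>f2 f3. pqq_frame G p q e1 f2 f3 \<and> canonical_pair (point G e1 f2 f3) p q A B"
proof -
  have sub: "A \<subseteq> carrier G" "B \<subseteq> carrier G" using fac unfolding factorization_def by auto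
  from sub(1) show ?thesis
  proof (cases rule: dimension_cases)
    case zero
    obtain x s t where "pt x s t \<in> A" "\<not> int q dvd 1 * t - 0 * s"
      using generating_Q[OF gen sub(1), of 1 0] q_neq_1 by auto
    with zero show ?thesis by (metis cong_0_iff diff_zero mult_1 mult_zero_left point_eq_iff)
  next
    case (one f2 f3 x1)
    interpret F: pqq_frame G p q e1 f2 f3 by (rule one(1))
    obtain x s t where "F.pt x s t \<in> A" "\<not> int q dvd 1 * t - 0 * s"
      using F.generating_Q[OF gen sub(1), of 1 0] q_neq_1 by auto
    with one(2) show ?thesis by (metis cong_0_iff diff_zero mult_1 mult_zero_left F.point_eq_iff)
  next
    case (two h2 h3 y z)
    interpret H: pqq_frame G p q e1 h2 h3 by (rule two(1))
    obtain f2 f3 where f: "pqq_frame G p q e1 f2 f3" and q: "q = 3"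
      and A: "A = {point G e1 f2 f3 0 0 0, point G e1 f2 f3 y 0 1, point G e1 f2 f3 z 1 2}"
      using H.triple_frame[OF fac cards(1) q3 one_mem(1) two(2,3)] .
    interpret F: pqq_frame G p q e1 f2 f3 by (rule f)
    have "\<not> int p dvd y \<or> \<not> int p dvd z"
    proof -
      obtain x s t where x: "F.pt x s t \<in> A" "\<not> int p dvd x" using F.generating_P[OF gen sub(1)] by blast
      then have "[x = 0] (mod int p) \<or> [x = y] (mod int p) \<or> [x = z] (mod int p)"
        unfolding A by (auto simp: F.point_eq_iff)
      then show ?thesis using x(2) cong_dvd_iff by (metis cong_0_iff cong_sym cong_trans)
    qed
    from F.triple_is_cylinder[OF fac cards q one_mem(2) A this]
    have B: "B = {F.pt (int i) (int j) 0 | i j. i < p \<and> j < q}" .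
    obtain a1 :: nat where a1: "[int a1 = y] (mod int p)" "[int a1 = 0] (mod int q)"
      using residue_pair by blast
    obtain a2 :: nat where a2: "[int a2 = z] (mod int p)" "[int a2 = 1] (mod int q)"
      using residue_pair by blast
    define \<alpha> :: "nat \<Rightarrow> int" where "\<alpha> = (\<lambda>i. if i = 0 then 0 else if i = 1 then int a1 else int a2)"
    have "{F.pt (\<alpha> i) (\<alpha> i) (int i) | i. i < q} =
        {F.pt (\<alpha> 0) (\<alpha> 0) (int 0), F.pt (\<alpha> 1) (\<alpha> 1) (int 1), F.pt (\<alpha> 2) (\<alpha> 2) (int 2)}"
      unfolding q by (rule family_of_three)
    also have "F.pt (\<alpha> 1) (\<alpha> 1) (int 1) = F.pt y 0 1" using a1 by (simp add: \<alpha>_def F.point_eq_iff)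
    also have "F.pt (\<alpha> 2) (\<alpha> 2) (int 2) = F.pt z 1 2" using a2 by (simp add: \<alpha>_def F.point_eq_iff)
    also have "{F.pt (\<alpha> 0) (\<alpha> 0) (int 0), F.pt y 0 1, F.pt z 1 2} = A" unfolding A by (simp add: \<alpha>_def)
    finally have A': "A = {F.pt (\<alpha> i) (\<alpha> i) (int i) | i. i < q}" by simp
    have "\<alpha> 0 = 0" by (simp add: \<alpha>_def)
    then show ?thesis using canonical_pair.triple_cylinder[OF q _ A' B] f by blast
  qed
qed

text \<open>
  If \<open>C\<close> lies over a line, \<open>A\<close> meets each translate of that line within a fibre exactly once: an
  arbitrary such graph if \<open>C\<close> lies in the plane, and a cylinder otherwise. If \<open>C\<close> is a triple, it lies in
  the plane, since otherwise \<open>A\<close> would be a proper subgroup.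
\<close>
theorem complement_of_factor_of_order_q:
  assumes fac: "factorization G C A" and cards: "card C = q" "card A = p * q" and q3: "q \<le> 3"
    and one_mem: "\<one> \<in> C" "\<one> \<in> A" and gen: "generate G A = carrier G"
  shows "\<exists>f2 f3. pqq_frame G p q e1 f2 f3 \<and> canonical_pair (point G e1 f2 f3) p q A C"
proof -
  have sub: "C \<subseteq> carrier G" "A \<subseteq> carrier G" using fac unfolding factorization_def by auto
  note L = fac cards one_mem
  from sub(1) show ?thesis
  proof (cases rule: dimension_cases)
    case zero
    then have "\<exists>x s. g = pt x s 0" if "g \<in> C" for g using that by blast
    from Q_line_cover[OF L this] obtain x where "pt x 1 0 \<in> C" by blast
    then obtain x' where "pt x 1 0 = pt x' 0 0" using zero by blast
    then show ?thesis using q_neq_1 by (simp add: point_eq_iff cong_0_iff)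
  next
    case (one f2 f3 x1)
    interpret F: pqq_frame G p q e1 f2 f3 by (rule one(1))
    have z: "F.pt 0 0 0 \<in> A" "F.pt 0 0 0 \<in> C" using one_mem F.point_zero by auto
    have line: "\<exists>x. F.pt x s 0 \<in> C" for s using F.Q_line_cover[OF L one(2)] by blast
    have line_unique: "F.pt x s 0 = F.pt x' s' 0"
      if "F.pt x s 0 \<in> C" "F.pt x' s' 0 \<in> C" "[s = s'] (mod int q)" for x s x' s'
      using F.Q_unique[OF L that(1,2) z(1) z(1), of 1] that(3) q_neq_1 by simp
    have cover: "\<exists>s. F.pt x s t \<in> A" for x t
    proof -
      obtain x1 s1 t1 where c: "F.pt x1 s1 t1 \<in> C" "F.pt x (0 - s1) (t - t1) \<in> A"
        using F.Q_cover[OF L] by blast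
      then obtain x' s' where "F.pt x1 s1 t1 = F.pt x' s' 0" using one(2) by blast
      then have "F.pt x (0 - s1) t \<in> A"
        by (intro F.point_in_cong[OF c(2)]) (auto simp: F.point_eq_iff cong_iff_dvd_diff)
      then show ?thesis by blast
    qed
    have fibre_unique: "[s = s'] (mod int q)"
      if "F.pt x s t \<in> A" "F.pt x' s' t' \<in> A" "[x = x'] (mod int p)" "[t = t'] (mod int q)" for x s t x' s' t'
    proof -
      obtain x1 where x1: "F.pt x1 (s' - s) 0 \<in> C" using line by blast
      from F.Q_unique[OF L x1 z(2) that(1,2), of 1] that(3,4) q_neq_1 show ?thesis
        by (simp add: F.point_eq_iff)
    qed
    show ?thesis
    proof (cases "\<exists>x s. F.pt x s 0 \<in> C \<and> \<not> int p dvd x")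
      case False
      have C: "C = {F.pt 0 (int i) 0 | i. i < q}"
      proof (intro subset_antisym subsetI)
        fix g assume g: "g \<in> C"
        then obtain x s where x: "g = F.pt x s 0" using one(2) by blast
        obtain i where i: "i < q" "[s = int i] (mod int q)" using residue_representative[OF q_pos] .
        have "[x = 0] (mod int p)" using False g x by (auto simp: cong_0_iff)
        then have "g = F.pt 0 (int i) 0" using x i by (simp add: F.point_eq_iff)
        then show "g \<in> {F.pt 0 (int i) 0 | i. i < q}" using i by blast
      next
        fix g assume "g \<in> {F.pt 0 (int i) 0 | i. i < q}"
        then obtain i where g: "g = F.pt 0 (int i) 0" by blast
        obtain x where x: "F.pt x (int i) 0 \<in> C" using line by blast
        then have "[x = 0] (mod int p)" using False by (auto simp: cong_0_iff)
        then show "g \<in> C" unfolding g using F.point_in_cong[OF x] by simp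
      qed
      have "\<forall>i j. \<exists>s. F.pt (int i) s (int j) \<in> A \<and> (i = 0 \<and> j = 0 \<longrightarrow> s = 0)"
        using cover z(1) by (metis of_nat_0)
      then obtain \<gamma> where c: "\<And>i j. F.pt (int i) (\<gamma> i j) (int j) \<in> A" "\<gamma> 0 0 = 0" by metis
      have A: "A = {F.pt (int i) (\<gamma> i j) (int j) | i j. i < p \<and> j < q}"
      proof (intro subset_antisym subsetI)
        fix g assume g: "g \<in> A"
        then obtain x s t where x: "g = F.pt x s t" using F.point_surj sub by blast
        obtain i where i: "i < p" "[x = int i] (mod int p)" using residue_representative[OF p_pos] .
        obtain j where j: "j < q" "[t = int j] (mod int q)" using residue_representative[OF q_pos] .
        have "g = F.pt (int i) (\<gamma> i j) (int j)"
          using fibre_unique[of x s t "int i" "\<gamma> i j" "int j"] g x i j c by (simp add: F.point_eq_iff)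
        then show "g \<in> {F.pt (int i) (\<gamma> i j) (int j) | i j. i < p \<and> j < q}" using i j by blast
      qed (use c in auto)
      show ?thesis using canonical_pair.graph_line[OF c(2) A C] one(1) by blast
    next
      case True
      then obtain y s1 where y: "F.pt y s1 0 \<in> C" "\<not> int p dvd y" by blast
      have s1: "\<not> int q dvd s1"
      proof
        assume "int q dvd s1"
        then have "F.pt y s1 0 = F.pt 0 0 0" using line_unique[OF y(1) z(2)] by (simp add: cong_0_iff)
        then show False using y(2) by (simp add: F.point_eq_iff cong_0_iff)
      qed
      have cylinder: "[s = s'] (mod int q)"
        if "F.pt x s t \<in> A" "F.pt x' s' t' \<in> A" "[t = t'] (mod int q)" for x s t x' s' t'
      proof (rule ccontr)
        assume ne: "\<not> [s = s'] (mod int q)"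
        obtain l where l: "[l * s1 = s' - s] (mod int q)" using cong_solve_prime[OF prime_q s1] by blast
        have "\<not> int q dvd l"
        proof
          assume "int q dvd l"
          then have "[s' - s = 0] (mod int q)" using l by (metis cong_0_iff cong_sym cong_trans dvd_mult2)
          then show False using ne by (simp add: cong_0_iff cong_iff_dvd_diff dvd_diff_commute)
        qed
        from F.Q_unique[OF L y(1) z(2) that(1,2) this] l that(3) y(2)
        have "F.pt y s1 0 = F.pt 0 0 0" by (simp add: cong_0_iff cong_iff_dvd_diff algebra_simps)
        then show False using y(2) by (simp add: F.point_eq_iff cong_0_iff)
      qed
      have "\<forall>i. \<exists>s. F.pt 0 s (int i) \<in> A \<and> (i = 0 \<longrightarrow> s = 0)"
        using cover z(1) by (metis of_nat_0)
      then obtain \<alpha> where a: "\<And>i. F.pt 0 (\<alpha> i) (int i) \<in> A" "\<alpha> 0 = 0" by metis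
      have full: "F.pt x (\<alpha> i) (int i) \<in> A" for x i
      proof -
        obtain s where s: "F.pt x s (int i) \<in> A" using cover by blast
        then have "[s = \<alpha> i] (mod int q)" using cylinder[OF s a(1)] by simp
        then show ?thesis using F.point_in_cong[OF s] by simp
      qed
      have A: "A = {F.pt (int j) (\<alpha> i) (int i) | i j. i < q \<and> j < p}"
      proof (intro subset_antisym subsetI)
        fix g assume g: "g \<in> A"
        then obtain x s t where x: "g = F.pt x s t" using F.point_surj sub by blast
        obtain j where j: "j < p" "[x = int j] (mod int p)" using residue_representative[OF p_pos] .
        obtain i where i: "i < q" "[t = int i] (mod int q)" using residue_representative[OF q_pos] .
        have "g = F.pt (int j) (\<alpha> i) (int i)"
          using cylinder[of x s t 0 "\<alpha> i" "int i"] g x i j a by (simp add: F.point_eq_iff)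
        then show "g \<in> {F.pt (int j) (\<alpha> i) (int i) | i j. i < q \<and> j < p}" using i j by blast
      qed (use full in auto)
      have "\<forall>i. \<exists>x. F.pt x (int i) 0 \<in> C \<and> (i = 0 \<longrightarrow> x = 0)" using line z(2) by (metis of_nat_0)
      then obtain \<kappa> where k: "\<And>i. F.pt (\<kappa> i) (int i) 0 \<in> C" "\<kappa> 0 = 0" by metis
      have C: "C = {F.pt (\<kappa> i) (int i) 0 | i. i < q}"
      proof (intro subset_antisym subsetI)
        fix g assume g: "g \<in> C"
        then obtain x s where x: "g = F.pt x s 0" using one(2) by blast
        obtain i where i: "i < q" "[s = int i] (mod int q)" using residue_representative[OF q_pos] .
        have "g = F.pt (\<kappa> i) (int i) 0" using line_unique[OF _ k(1)] g x i by simp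
        then show "g \<in> {F.pt (\<kappa> i) (int i) 0 | i. i < q}" using i by blast
      qed (use k in auto)
      \<comment> \<open>For \<open>q = 2\<close> the base \<open>{0, (\<alpha> 1, 1)}\<close> of the cylinder would be a subgroup of the plane.\<close>
      have "q = 3"
      proof (rule ccontr)
        assume "q \<noteq> 3"
        then have q2: "q = 2" using q3 prime_ge_2_nat[OF prime_q] by simp
        obtain x s t where g: "F.pt x s t \<in> A" "\<not> int q dvd \<alpha> 1 * t - 1 * s"
          using F.generating_Q[OF gen sub(2), of "\<alpha> 1" 1] q_neq_1 by auto
        then obtain i j where i: "i < q" "F.pt x s t = F.pt (int j) (\<alpha> i) (int i)" unfolding A by blast
        then have c: "[s = \<alpha> i] (mod int q)" "[t = int i] (mod int q)" by (simp_all add: F.point_eq_iff)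
        have "[\<alpha> 1 * t - 1 * s = \<alpha> 1 * int i - 1 * \<alpha> i] (mod int q)"
          by (intro cong_diff cong_scalar_left c)
        moreover have "\<alpha> 1 * int i - 1 * \<alpha> i = 0"
          using i(1) q2 a(2) by (cases i) auto
        ultimately show False using g(2) by (simp add: cong_0_iff)
      qed
      then show ?thesis using canonical_pair.cylinder_skew_line[OF _ a(2) k(2) A C] one(1) by blast
    qed
  next
    case (two h2 h3 y z)
    interpret H: pqq_frame G p q e1 h2 h3 by (rule two(1))
    obtain f2 f3 where f: "pqq_frame G p q e1 f2 f3" and q: "q = 3"
      and C: "C = {point G e1 f2 f3 0 0 0, point G e1 f2 f3 y 0 1, point G e1 f2 f3 z 1 2}"
      using H.triple_frame[OF fac cards(1) q3 one_mem(1) two(2,3)] .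
    interpret F: pqq_frame G p q e1 f2 f3 by (rule f)
    note T = fac cards q one_mem(2) C
    have zA: "F.pt 0 0 0 \<in> A" using one_mem F.point_zero by simp
    have yz: "[y = 0] (mod int p)" "[z = 0] (mod int p)"
    proof -
      have "int p dvd y \<and> int p dvd z"
      proof (rule ccontr)
        assume "\<not> ?thesis"
        then have A: "A = {F.pt (int i) (int j) 0 | i j. i < p \<and> j < q}" using F.triple_is_cylinder[OF T] by blast
        obtain x s t where g: "F.pt x s t \<in> A" "\<not> int q dvd 1 * t - 0 * s"
          using F.generating_Q[OF gen sub(2), of 1 0] q_neq_1 by auto
        then obtain i j where "F.pt x s t = F.pt (int i) (int j) 0" unfolding A by blast
        then show False using g(2) by (simp add: F.point_eq_iff cong_0_iff)
      qed
      then show "[y = 0] (mod int p)" "[z = 0] (mod int p)" by (simp_all add: cong_0_iff)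
    qed
    define \<kappa> :: "nat \<Rightarrow> int" where "\<kappa> = (\<lambda>i. if i = 2 then 1 else 0)"
    have "{F.pt 0 (\<kappa> i) (int i) | i. i < q} =
        {F.pt 0 (\<kappa> 0) (int 0), F.pt 0 (\<kappa> 1) (int 1), F.pt 0 (\<kappa> 2) (int 2)}"
      unfolding q by (rule family_of_three)
    also have "F.pt 0 (\<kappa> 1) (int 1) = F.pt y 0 1" using yz by (simp add: \<kappa>_def F.point_eq_iff cong_sym)
    also have "F.pt 0 (\<kappa> 2) (int 2) = F.pt z 1 2" using yz by (simp add: \<kappa>_def F.point_eq_iff cong_sym)
    also have "{F.pt 0 (\<kappa> 0) (int 0), F.pt y 0 1, F.pt z 1 2} = C" unfolding C by (simp add: \<kappa>_def)
    finally have C': "C = {F.pt 0 (\<kappa> i) (int i) | i. i < q}" by simp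
    have "\<forall>i. \<exists>t. F.pt (int i) 0 t \<in> A \<and> (i = 0 \<longrightarrow> t = 0)"
      using F.triple_nonempty[OF T] F.triple_fibre_shift[OF T] zA by (metis of_nat_0)
    then obtain \<alpha> where a: "\<And>i. F.pt (int i) 0 (\<alpha> i) \<in> A" "\<alpha> 0 = 0" by metis
    have A: "A = {F.pt (int i) (int j) (\<alpha> i) | i j. i < p \<and> j < q}"
    proof (intro subset_antisym subsetI)
      fix g assume g: "g \<in> A"
      then obtain x s t where x: "g = F.pt x s t" using F.point_surj sub by blast
      obtain i where i: "i < p" "[x = int i] (mod int p)" using residue_representative[OF p_pos] .
      obtain j where j: "j < q" "[s = int j] (mod int q)" using residue_representative[OF q_pos] .
      have "[t = \<alpha> i] (mod int q)" using F.triple_fibre[OF T, of x s t "int i" 0 "\<alpha> i"] g x a i by blast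
      then have "g = F.pt (int i) (int j) (\<alpha> i)" using x i j by (simp add: F.point_eq_iff)
      then show "g \<in> {F.pt (int i) (int j) (\<alpha> i) | i j. i < p \<and> j < q}" using i j by blast
    qed (auto intro: F.triple_fibre_shift[OF T a(1)])
    have "\<kappa> 0 = 0" by (simp add: \<kappa>_def)
    then show ?thesis using canonical_pair.cosets_transversal[OF a(2) _ A C'] f by blast
  qed
qed

end

section \<open>Classification of factorizations\<close>

context pqq_frame
begin

text \<open>
  The order of \<open>A\<close> divides \<open>p q\<^sup>2\<close>. Order \<open>1\<close> contradicts generation and order \<open>p q\<^sup>2\<close> properness.
\<close>
theorem factorization_canonical:
  assumes fac: "factorization G A C" and q3: "q \<le> 3" and one_mem: "\<one> \<in> A" "\<one> \<in> C"
    and gen: "generate G A = carrier G" and proper: "A \<noteq> carrier G"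
  shows "\<exists>f2 f3. pqq_frame G p q e1 f2 f3 \<and> canonical_pair (point G e1 f2 f3) p q A C"
proof -
  have sub: "A \<subseteq> carrier G" using fac unfolding factorization_def by auto
  have fac': "factorization G C A" by (rule factorization_commute[OF fac])
  have card: "card A * card C = p * (q * q)" using factorization_card[OF fac] card_carrier by simp
  then have "card A dvd p * (q * q)" by (metis dvd_triv_left)
  then obtain a b c where abc: "card A = a * (b * c)" "a dvd p" "b dvd q" "c dvd q"
    by (metis division_decomp)
  then have "a = 1 \<or> a = p" "b = 1 \<or> b = q" "c = 1 \<or> c = q"
    using prime_p prime_q by (auto simp: prime_nat_iff)
  then consider "card A = 1" | "card A = p" | "card A = q" | "card A = p * q"
    | "card A = q * q" | "card A = p * (q * q)" using abc(1) by fastforce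
  then show ?thesis
  proof cases
    case 1
    then have "A = {\<one>}" using one_mem(1) by (metis card_1_singletonE singletonD)
    moreover obtain x s t where "pt x s t \<in> A" "\<not> int p dvd x"
      using generating_P[OF gen sub] by blast
    ultimately show ?thesis using point_zero by (metis point_eq_iff cong_0_iff singletonD)
  next
    case 2
    then have "card C = q * q" using card p_pos by simp
    then show ?thesis using generating_factor_of_order_p[OF fac 2 _ one_mem gen] by blast
  next
    case 3
    then have "card C = p * q" using card q_pos by (simp add: mult.left_commute)
    then show ?thesis using generating_factor_of_order_q[OF fac 3 _ q3 one_mem gen] by blast
  next
    case 4
    then have "card C = q" using card p_pos q_pos by simp
    then show ?thesis using complement_of_factor_of_order_q[OF fac' _ 4 q3 one_mem(2,1) gen] by blast
  next
    case 5
    then have "card C = p" using card q_pos by simp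
    then show ?thesis using complement_of_factor_of_order_p[OF fac' _ 5 one_mem(2,1) gen] by blast
  next
    case 6
    then show ?thesis using card_subset_eq[OF finite_carrier sub] card_carrier proper by simp
  qed
qed

end

section \<open>Perfect codes and frames in the concrete group\<close>

lemma closed_out_nbhd_cayley:
  assumes "group G" "S \<subseteq> carrier G" "c \<in> carrier G"
  shows "closed_out_nbhd (cayley_digraph G S) c = (\<lambda>a. a \<otimes>\<^bsub>G\<^esub> c) ` (S \<union> {\<one>\<^bsub>G\<^esub>})"
proof -
  interpret group G by fact
  have arc: "c \<rightarrow>\<^bsub>cayley_digraph G S\<^esub> v \<longleftrightarrow> v \<in> carrier G \<and> v \<otimes>\<^bsub>G\<^esub> inv\<^bsub>G\<^esub> c \<in> S" for v
    using assms(3) by (auto simp: arcs_ends_conv cayley_digraph_def image_iff)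
  have "{v. c \<rightarrow>\<^bsub>cayley_digraph G S\<^esub> v} = (\<lambda>a. a \<otimes>\<^bsub>G\<^esub> c) ` S"
  proof (intro subset_antisym subsetI)
    fix v assume "v \<in> {v. c \<rightarrow>\<^bsub>cayley_digraph G S\<^esub> v}"
    then have v: "v \<in> carrier G" "v \<otimes>\<^bsub>G\<^esub> inv\<^bsub>G\<^esub> c \<in> S" using arc by auto
    then show "v \<in> (\<lambda>a. a \<otimes>\<^bsub>G\<^esub> c) ` S"
      using assms(3) by (intro image_eqI[OF _ v(2)]) (simp add: m_assoc)
  next
    fix v assume "v \<in> (\<lambda>a. a \<otimes>\<^bsub>G\<^esub> c) ` S"
    then obtain a where "v = a \<otimes>\<^bsub>G\<^esub> c" "a \<in> S" "a \<in> carrier G" using assms(2) by blast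
    then show "v \<in> {v. c \<rightarrow>\<^bsub>cayley_digraph G S\<^esub> v}" using arc assms(3) by (simp add: m_assoc)
  qed
  then show ?thesis unfolding closed_out_nbhd_def using assms(3) by auto
qed

lemma (in comm_group) perfect_code_iff_factorization:
  assumes S: "S \<subseteq> carrier G" and C: "C \<subseteq> carrier G"
  shows "perfect_code (cayley_digraph G S) C \<longleftrightarrow> factorization G (S \<union> {\<one>}) C"
proof -
  let ?A = "S \<union> {\<one>}"
  let ?f = "\<lambda>(a, b). a \<otimes> b"
  let ?N = "closed_out_nbhd (cayley_digraph G S)"
  have A: "?A \<subseteq> carrier G" using S by auto
  have N: "?N c = (\<lambda>a. a \<otimes> c) ` ?A" if "c \<in> C" for c
    using closed_out_nbhd_cayley[OF is_group S] that C by blast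
  have "(\<Union>c\<in>C. ?N c) = ?f ` (?A \<times> C)" using N by auto
  moreover have "disjoint_family_on ?N C \<longleftrightarrow> inj_on ?f (?A \<times> C)"
  proof
    assume d: "disjoint_family_on ?N C"
    show "inj_on ?f (?A \<times> C)"
    proof (rule inj_onI, clarify)
      fix a c a' c' assume *: "a \<in> ?A" "c \<in> C" "a' \<in> ?A" "c' \<in> C" "a \<otimes> c = a' \<otimes> c'"
      then have "a \<otimes> c \<in> ?N c \<inter> ?N c'" using N by (metis IntI imageI)
      then have "c = c'" using d *(2,4) unfolding disjoint_family_on_def by blast
      moreover have "a \<in> carrier G" "a' \<in> carrier G" "c \<in> carrier G" using * A C by auto
      ultimately show "a = a' \<and> c = c'" using *(5) right_cancel by simp
    qed
  next
    assume inj: "inj_on ?f (?A \<times> C)"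
    show "disjoint_family_on ?N C"
      unfolding disjoint_family_on_def
    proof (intro ballI impI)
      fix c c' assume c: "c \<in> C" "c' \<in> C" "c \<noteq> c'"
      show "?N c \<inter> ?N c' = {}"
      proof (rule ccontr)
        assume "?N c \<inter> ?N c' \<noteq> {}"
        then obtain a a' where a: "a \<in> ?A" "a' \<in> ?A" "a \<otimes> c = a' \<otimes> c'"
          unfolding N[OF c(1)] N[OF c(2)] by blast
        then have "(a, c) = (a', c')" using inj_onD[OF inj, of "(a, c)" "(a', c')"] c by simp
        then show False using c by simp
      qed
    qed
  qed
  ultimately show ?thesis
    unfolding perfect_code_def factorization_def bij_betw_def using A C
    by (auto simp: cayley_digraph_def)
qed

lemma int_pow_DirProd:
  assumes "group G" "group H" "g \<in> carrier G" "h \<in> carrier H"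
  shows "(g, h) [^]\<^bsub>G \<times>\<times> H\<^esub> (z :: int) = (g [^]\<^bsub>G\<^esub> z, h [^]\<^bsub>H\<^esub> z)"
proof -
  have n: "(g, h) [^]\<^bsub>G \<times>\<times> H\<^esub> (n :: nat) = (g [^]\<^bsub>G\<^esub> n, h [^]\<^bsub>H\<^esub> n)" for n
    by (induction n) simp_all
  have "g [^]\<^bsub>G\<^esub> (n :: nat) \<in> carrier G" "h [^]\<^bsub>H\<^esub> (n :: nat) \<in> carrier H" for n
    using assms by (meson group.is_monoid monoid.nat_pow_closed)+
  from inv_DirProd[OF assms(1,2) this, of "nat (- z)" "nat (- z)"]
  show ?thesis by (simp only: int_pow_def2 n if_distrib split: if_split) simp
qed

lemma int_pow_integer_mod_triple:
  assumes "(a, b, c) \<in> carrier (integer_mod_group p \<times>\<times> integer_mod_group q \<times>\<times> integer_mod_group r)"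
  shows "(a, b, c) [^]\<^bsub>integer_mod_group p \<times>\<times> integer_mod_group q \<times>\<times> integer_mod_group r\<^esub> (z :: int) =
    (z * a mod int p, z * b mod int q, z * c mod int r)"
  using assms by (simp add: int_pow_DirProd DirProd_group int_pow_integer_mod_group)

context
  fixes p q :: nat and G :: "(int \<times> int \<times> int) monoid" (structure) and e1 :: "int \<times> int \<times> int"
  assumes prime_p: "prime p" and prime_q: "prime q" and p_neq_q: "p \<noteq> q"
    and G: "G = integer_mod_group p \<times>\<times> integer_mod_group q \<times>\<times> integer_mod_group q"
    and e1: "e1 = (1, 0, 0)"
begin

lemma carrier_G: "carrier G = {0..<int p} \<times> {0..<int q} \<times> {0..<int q}"
  using prime_p prime_q by (auto simp: G carrier_integer_mod_group)

lemma std_point: "point G e1 (0, 1, 0) (0, 0, 1) x s t = (x mod int p, s mod int q, t mod int q)"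
proof -
  have mem: "e1 \<in> carrier G" "(0, 1, 0) \<in> carrier G" "(0, 0, 1) \<in> carrier G"
    using prime_gt_1_nat[OF prime_p] prime_gt_1_nat[OF prime_q] by (simp_all add: carrier_G e1)
  show ?thesis
    unfolding point_def using mem by (simp add: e1 G int_pow_integer_mod_triple)
qed

lemma comm_group_G: "comm_group G"
proof -
  have "group G" unfolding G by (simp add: DirProd_group)
  then show ?thesis
    by (rule group.group_comm_groupI) (auto simp: G add.commute)
qed

lemma std_frame: "pqq_frame G p q e1 (0, 1, 0) (0, 0, 1)"
proof -
  interpret comm_group G by (rule comm_group_G)
  show ?thesis
  proof (unfold_locales, goal_cases)
    case (7 g)
    then have "g = point G e1 (0, 1, 0) (0, 0, 1) (fst g) (fst (snd g)) (snd (snd g))"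
      unfolding std_point by (auto simp: carrier_G)
    then show ?case by blast
  next
    case 8
    show ?case unfolding std_point by (simp add: cong_def)
  qed (use prime_p prime_q p_neq_q prime_gt_1_nat[OF prime_p] prime_gt_1_nat[OF prime_q]
      in \<open>auto simp: carrier_G e1\<close>)
qed

text \<open>
  The plane is the \<open>q\<close>-torsion of \<open>G\<close>, and \<open>e2\<close>, \<open>e3\<close> have order \<open>q\<close>.
\<close>
lemma frame_generates:
  assumes "pqq_frame G p q e1 e2 e3"
  shows "generate G {e2, e3} = {0} \<times> carrier (integer_mod_group q) \<times> carrier (integer_mod_group q)"
proof -
  interpret E: pqq_frame G p q e1 "(0, 1, 0)" "(0, 0, 1)" by (rule std_frame)
  interpret F: pqq_frame G p q e1 e2 e3 by (rule assms)
  have cq: "carrier (integer_mod_group q) = {0..<int q}" using E.q_pos by (simp add: carrier_integer_mod_group)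
  let ?Q = "{0 :: int} \<times> {0..<int q} \<times> {0..<int q}"
  have Q: "?Q = {E.pt 0 s t | s t. True}"
  proof (intro subset_antisym subsetI)
    fix g assume "g \<in> ?Q"
    then have "g = E.pt 0 (fst (snd g)) (snd (snd g))" unfolding std_point by auto
    then show "g \<in> {E.pt 0 s t | s t. True}" by blast
  qed (use E.q_pos in \<open>auto simp: std_point\<close>)
  have sub: "subgroup ?Q G" unfolding Q
  proof (rule E.subgroupI)
    show "{E.pt 0 s t | s t. True} \<noteq> {}" by blast
    show "inv a \<in> {E.pt 0 s t | s t. True}" if "a \<in> {E.pt 0 s t | s t. True}" for a
      using that E.point_inv[of 0] by force
    show "a \<otimes> b \<in> {E.pt 0 s t | s t. True}"
      if "a \<in> {E.pt 0 s t | s t. True}" "b \<in> {E.pt 0 s t | s t. True}" for a b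
      using that E.point_mult[of 0 _ _ 0] by force
  qed auto
  have torsion: "g \<in> ?Q" if g: "g \<in> carrier G" "g [^] q = \<one>" for g
  proof -
    obtain x s t where x: "g = E.pt x s t" using E.point_surj g by blast
    then have "E.pt (int q * x) (int q * s) (int q * t) = E.pt 0 0 0"
      using g by (simp add: E.point_pow E.point_zero)
    then have "int p dvd int q * x" by (simp add: E.point_eq_iff cong_0_iff)
    moreover have "coprime (int p) (int q)" using prime_p prime_q p_neq_q primes_coprime by auto
    ultimately have "int p dvd x" by (simp add: coprime_dvd_mult_right_iff)
    then have "g = E.pt 0 s t" unfolding x E.point_eq_iff by (simp add: cong_0_iff)
    then show ?thesis unfolding Q by blast
  qed
  have e: "e2 = F.pt 0 1 0" "e3 = F.pt 0 0 1" using F.e_closed by (simp_all add: point_def)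
  have "F.pt 0 (int q) 0 = F.pt 0 0 0" "F.pt 0 0 (int q) = F.pt 0 0 0"
    unfolding F.point_eq_iff by (simp_all add: cong_0_iff)
  then have "F.pt 0 1 0 [^] q = \<one>" "F.pt 0 0 1 [^] q = \<one>" by (simp_all add: F.point_pow F.point_zero)
  then have "e2 [^] q = \<one>" "e3 [^] q = \<one>" by (simp_all only: e[symmetric])
  then have "{e2, e3} \<subseteq> ?Q" using torsion F.e_closed by blast
  then have 1: "generate G {e2, e3} \<subseteq> ?Q" using E.generate_subgroup_incl[OF _ sub] by blast
  have 2: "?Q \<subseteq> generate G {e2, e3}"
  proof
    fix g assume "g \<in> ?Q"
    then obtain s t where g: "g = E.pt 0 s t" unfolding Q by blast
    then have "g \<in> carrier G" using E.point_closed by metis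
    then obtain x a b where x: "g = F.pt x a b" using F.point_surj by blast
    interpret H: subgroup "generate G {e2, e3}" G by (rule E.generate_is_subgroup) (use F.e_closed in simp)
    have "F.pt (int q * x) (int q * a) (int q * b) = E.pt (int q * 0) (int q * s) (int q * t)"
      using F.point_pow[of x a b q] E.point_pow[of 0 s t q] g x by simp
    also have "\<dots> = F.pt 0 0 0" unfolding F.point_zero E.point_zero[symmetric] E.point_eq_iff
      by (simp add: cong_0_iff)
    finally have "int p dvd int q * x" by (simp add: F.point_eq_iff cong_0_iff)
    moreover have "coprime (int p) (int q)" using prime_p prime_q p_neq_q primes_coprime by auto
    ultimately have "int p dvd x" by (simp add: coprime_dvd_mult_right_iff)
    then have "g = F.pt 0 a b" unfolding x F.point_eq_iff by (simp add: cong_0_iff)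
    then have "g = e2 [^] a \<otimes> e3 [^] b" using F.e_closed by (simp add: point_def)
    moreover have "e2 \<in> generate G {e2, e3}" "e3 \<in> generate G {e2, e3}" by (simp_all add: generate.incl)
    ultimately show "g \<in> generate G {e2, e3}"
      using E.subgroup_int_pow_closed[OF H.subgroup_axioms] by simp
  qed
  from 1 2 show ?thesis unfolding cq by blast
qed

text \<open>
  If the determinant of \<open>e2\<close>, \<open>e3\<close> in the standard basis vanished, some nonzero linear form would
  vanish on \<open>e1\<close>, \<open>e2\<close>, \<open>e3\<close>, although these generate \<open>G\<close>.
\<close>
lemma generates_frame:
  assumes gen: "generate G {e2, e3} = {0} \<times> carrier (integer_mod_group q) \<times> carrier (integer_mod_group q)"
  shows "pqq_frame G p q e1 e2 e3"
proof -
  interpret E: pqq_frame G p q e1 "(0, 1, 0)" "(0, 0, 1)" by (rule std_frame)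
  have cq: "carrier (integer_mod_group q) = {0..<int q}" using E.q_pos by (simp add: carrier_integer_mod_group)
  have "e2 \<in> generate G {e2, e3}" "e3 \<in> generate G {e2, e3}" by (simp_all add: generate.incl)
  then obtain a b c d where abcd: "e2 = (0, a, b)" "e3 = (0, c, d)"
    "a \<in> {0..<int q}" "b \<in> {0..<int q}" "c \<in> {0..<int q}" "d \<in> {0..<int q}" unfolding gen cq by auto
  then have e: "e2 = E.pt 0 a b" "e3 = E.pt 0 c d" by (simp_all add: std_point)
  have e1': "e1 = E.pt 1 0 0" using E.e_closed by (simp add: point_def)
  let ?A = "{e1, e2, e3}"
  have A: "?A \<subseteq> carrier G" using E.e_closed e by auto
  have genA: "generate G ?A = carrier G"
  proof
    show "generate G ?A \<subseteq> carrier G" using E.generate_incl[OF A] .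
    interpret H: subgroup "generate G ?A" G by (rule E.generate_is_subgroup[OF A])
    show "carrier G \<subseteq> generate G ?A"
    proof
      fix g assume "g \<in> carrier G"
      then obtain x s t where g: "g = E.pt x s t" using E.point_surj by blast
      have "E.pt 0 s t \<in> generate G {e2, e3}" unfolding gen cq std_point using E.q_pos by simp
      then have "E.pt 0 s t \<in> generate G ?A" using E.mono_generate[of "{e2, e3}" ?A] by blast
      moreover have "e1 [^] x \<in> generate G ?A"
        using E.subgroup_int_pow_closed[OF H.subgroup_axioms, of e1 x] by (simp add: generate.incl)
      moreover have "g = e1 [^] x \<otimes> E.pt 0 s t"
        using E.e_closed unfolding g point_def by (simp add: E.m_assoc)
      ultimately show "g \<in> generate G ?A" by simp
    qed
  qed
  have det_zero: "\<not> int q dvd u * b - v * a \<or> \<not> int q dvd u * d - v * c"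
    if uv: "\<not> (int q dvd u \<and> int q dvd v)" for u v
  proof -
    obtain x s t where x: "E.pt x s t \<in> ?A" "\<not> int q dvd u * t - v * s"
      using E.generating_Q[OF genA A uv] by blast
    have "\<not> int q dvd u * t' - v * s'" if "[s = s'] (mod int q)" "[t = t'] (mod int q)" for s' t'
    proof -
      have "[u * t - v * s = u * t' - v * s'] (mod int q)"
        by (intro cong_diff cong_scalar_left that)
      then show ?thesis using x(2) by (metis cong_0_iff cong_sym cong_trans)
    qed
    moreover have "E.pt x s t = E.pt 1 0 0 \<or> E.pt x s t = E.pt 0 a b \<or> E.pt x s t = E.pt 0 c d"
      using x(1) e e1' by auto
    ultimately show ?thesis unfolding E.point_eq_iff by fastforce
  qed
  have "\<not> int q dvd a * d - b * c"
  proof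
    assume det: "int q dvd a * d - b * c"
    have ab: "int q dvd a \<and> int q dvd b"
      using det_zero[of a b] det by (auto simp: mult.commute)
    have cd: "int q dvd c \<and> int q dvd d"
    proof -
      have "int q dvd c * b - d * a" using ab by simp
      then show ?thesis using det_zero[of c d] by (auto simp: mult.commute)
    qed
    show False using det_zero[of 1 0] ab cd E.q_neq_1 by auto
  qed
  then show ?thesis unfolding e by (rule E.frame_change)
qed

end

theorem theorem3p4:
  fixes p q :: nat
    and G :: "(int \<times> int \<times> int) monoid" (structure)
    and S S\<^sub>0 C :: "(int \<times> int \<times> int) set"
    and e\<^sub>1 :: "int \<times> int \<times> int"
  assumes "prime p" and "prime q" and "p \<noteq> q" and "p \<ge> 3" and "3 \<ge> q"
    and G: "G = integer_mod_group p \<times>\<times> integer_mod_group q \<times>\<times> integer_mod_group q"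
    and S: "S \<subset> carrier G - {\<one>}" and gen: "generate G S = carrier G"
    and S\<^sub>0: "S\<^sub>0 = S \<union> {\<one>}"
    and C: "\<one> \<in> C" "C \<subseteq> carrier G"
    and e\<^sub>1: "e\<^sub>1 = (1, 0, 0)"
  shows "perfect_code (cayley_digraph G S) C \<longleftrightarrow>
    (\<exists>e\<^sub>2\<in>carrier G. \<exists>e\<^sub>3\<in>carrier G.
      generate G {e\<^sub>2, e\<^sub>3} =
        {0} \<times> carrier (integer_mod_group q) \<times> carrier (integer_mod_group q) \<and>
      (\<exists>(\<alpha> :: nat \<Rightarrow> int) (\<beta> :: nat \<Rightarrow> int) (\<kappa> :: nat \<Rightarrow> int) (\<alpha>\<alpha> :: nat \<Rightarrow> nat \<Rightarrow> int).
        \<alpha> 0 = 0 \<and> \<beta> 0 = 0 \<and> \<kappa> 0 = 0 \<and> \<alpha>\<alpha> 0 0 = 0 \<and>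
        ((S\<^sub>0 = {e\<^sub>1 [^] i \<otimes> e\<^sub>2 [^] \<alpha> i \<otimes> e\<^sub>3 [^] \<beta> i | i. i \<in> {..<p}} \<and>
          C = {e\<^sub>2 [^] i \<otimes> e\<^sub>3 [^] j | i j. i \<in> {..<q} \<and> j \<in> {..<q}})
       \<or> (q = 3 \<and>
          S\<^sub>0 = {e\<^sub>1 [^] \<alpha> i \<otimes> e\<^sub>2 [^] \<alpha> i \<otimes> e\<^sub>3 [^] i | i. i \<in> {..<3::nat}} \<and>
          C = {e\<^sub>1 [^] i \<otimes> e\<^sub>2 [^] j | i j. i \<in> {..<p} \<and> j \<in> {..<3::nat}})
       \<or> (q = 3 \<and>
          S\<^sub>0 = {e\<^sub>1 [^] j \<otimes> e\<^sub>2 [^] \<alpha> i \<otimes> e\<^sub>3 [^] i | i j. i \<in> {..<3::nat} \<and> j \<in> {..<p}} \<and>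
          C = {e\<^sub>1 [^] \<kappa> i \<otimes> e\<^sub>2 [^] i | i. i \<in> {..<3::nat}})
       \<or> (S\<^sub>0 = {e\<^sub>1 [^] i \<otimes> e\<^sub>2 [^] j \<otimes> e\<^sub>3 [^] \<alpha> i | i j. i \<in> {..<p} \<and> j \<in> {..<q}} \<and>
          C = {e\<^sub>2 [^] \<kappa> i \<otimes> e\<^sub>3 [^] i | i. i \<in> {..<q}})
       \<or> (S\<^sub>0 = {e\<^sub>1 [^] i \<otimes> e\<^sub>2 [^] \<alpha>\<alpha> i j \<otimes> e\<^sub>3 [^] j | i j. i \<in> {..<p} \<and> j \<in> {..<q}} \<and>
          C = {e\<^sub>2 [^] i | i. i \<in> {..<q}})
       \<or> (S\<^sub>0 = {e\<^sub>1 [^] \<alpha> i \<otimes> e\<^sub>2 [^] j \<otimes> e\<^sub>3 [^] i | i j. i \<in> {..<q} \<and> j \<in> {..<q}} \<and>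
          C = {e\<^sub>1 [^] i \<otimes> e\<^sub>2 [^] \<kappa> i | i. i \<in> {..<p}})
       \<or> (S\<^sub>0 = {e\<^sub>1 [^] \<alpha>\<alpha> i j \<otimes> e\<^sub>2 [^] i \<otimes> e\<^sub>3 [^] j | i j. i \<in> {..<q} \<and> j \<in> {..<q}} \<and>
          C = {e\<^sub>1 [^] i | i. i \<in> {..<p}}))))"
proof -
  let "_ \<longleftrightarrow> (\<exists>e\<^sub>2\<in>_. \<exists>e\<^sub>3\<in>_. ?N e\<^sub>2 e\<^sub>3 \<and> ?D e\<^sub>2 e\<^sub>3)" = ?thesis
  note frames = \<open>prime p\<close> \<open>prime q\<close> \<open>p \<noteq> q\<close> G e\<^sub>1
  interpret E: pqq_frame G p q e\<^sub>1 "(0, 1, 0)" "(0, 0, 1)" by (rule std_frame[OF frames])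
  have SG: "S \<subseteq> carrier G" and S0G: "S\<^sub>0 \<subseteq> carrier G" using S S\<^sub>0 by auto
  have gen0: "generate G S\<^sub>0 = carrier G"
    using E.mono_generate[of S S\<^sub>0] E.generate_incl[OF S0G] gen S\<^sub>0 by blast
  have proper: "S\<^sub>0 \<noteq> carrier G" using S S\<^sub>0 by auto
  have one0: "\<one> \<in> S\<^sub>0" using S\<^sub>0 by simp
  have D: "?D e\<^sub>2 e\<^sub>3 \<longleftrightarrow> canonical_pair (point G e\<^sub>1 e\<^sub>2 e\<^sub>3) p q S\<^sub>0 C"
    if "pqq_frame G p q e\<^sub>1 e\<^sub>2 e\<^sub>3" for e\<^sub>2 e\<^sub>3
  proof -
    interpret F: pqq_frame G p q e\<^sub>1 e\<^sub>2 e\<^sub>3 by (rule that)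
    show ?thesis
    proof
      assume "?D e\<^sub>2 e\<^sub>3"
      then show "canonical_pair (point G e\<^sub>1 e\<^sub>2 e\<^sub>3) p q S\<^sub>0 C"
      proof (elim exE conjE disjE, goal_cases)
        case (1 \<alpha> \<beta> \<kappa> \<alpha>\<alpha>)
        then show ?case by (intro canonical_pair.transversal_plane[of \<alpha> \<beta>]) (simp_all add: point_def int_pow_int F.e_closed)
      next
        case (2 \<alpha> \<beta> \<kappa> \<alpha>\<alpha>)
        then show ?case by (intro canonical_pair.triple_cylinder[of _ \<alpha>]) (simp_all add: point_def int_pow_int F.e_closed)
      next
        case (3 \<alpha> \<beta> \<kappa> \<alpha>\<alpha>)
        then show ?case by (intro canonical_pair.cylinder_skew_line[of _ \<alpha> \<kappa>]) (simp_all add: point_def int_pow_int F.e_closed)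
      next
        case (4 \<alpha> \<beta> \<kappa> \<alpha>\<alpha>)
        then show ?case by (intro canonical_pair.cosets_transversal[of \<alpha> \<kappa>]) (simp_all add: point_def int_pow_int F.e_closed)
      next
        case (5 \<alpha> \<beta> \<kappa> \<alpha>\<alpha>)
        then show ?case by (intro canonical_pair.graph_line[of \<alpha>\<alpha>]) (simp_all add: point_def int_pow_int F.e_closed)
      next
        case (6 \<alpha> \<beta> \<kappa> \<alpha>\<alpha>)
        then show ?case by (intro canonical_pair.periodic_graph[of \<alpha> \<kappa>]) (simp_all add: point_def int_pow_int F.e_closed)
      next
        case (7 \<alpha> \<beta> \<kappa> \<alpha>\<alpha>)
        then show ?case by (intro canonical_pair.graph_axis[of \<alpha>\<alpha>]) (simp_all add: point_def int_pow_int F.e_closed)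
      qed
    next
      assume "canonical_pair (point G e\<^sub>1 e\<^sub>2 e\<^sub>3) p q S\<^sub>0 C"
      then show "?D e\<^sub>2 e\<^sub>3"
      proof cases
        case (transversal_plane \<alpha> \<beta>)
        then show ?thesis
          by (intro exI[of _ "\<alpha>"] exI[of _ "\<beta>"] exI[of _ "\<lambda>_. 0"] exI[of _ "\<lambda>_ _. 0"])
            (simp add: point_def int_pow_int F.e_closed)
      next
        case (triple_cylinder \<alpha>)
        then show ?thesis
          by (intro exI[of _ "\<alpha>"] exI[of _ "\<lambda>_. 0"] exI[of _ "\<lambda>_. 0"] exI[of _ "\<lambda>_ _. 0"])
            (simp add: point_def int_pow_int F.e_closed)
      next
        case (cylinder_skew_line \<alpha> \<kappa>)
        then show ?thesis
          by (intro exI[of _ "\<alpha>"] exI[of _ "\<lambda>_. 0"] exI[of _ "\<kappa>"] exI[of _ "\<lambda>_ _. 0"])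
            (simp add: point_def int_pow_int F.e_closed)
      next
        case (cosets_transversal \<alpha> \<kappa>)
        then show ?thesis
          by (intro exI[of _ "\<alpha>"] exI[of _ "\<lambda>_. 0"] exI[of _ "\<kappa>"] exI[of _ "\<lambda>_ _. 0"])
            (simp add: point_def int_pow_int F.e_closed)
      next
        case (graph_line \<gamma>)
        then show ?thesis
          by (intro exI[of _ "\<lambda>_. 0"] exI[of _ "\<lambda>_. 0"] exI[of _ "\<lambda>_. 0"] exI[of _ "\<gamma>"])
            (simp add: point_def int_pow_int F.e_closed)
      next
        case (periodic_graph \<alpha> \<kappa>)
        then show ?thesis
          by (intro exI[of _ "\<alpha>"] exI[of _ "\<lambda>_. 0"] exI[of _ "\<kappa>"] exI[of _ "\<lambda>_ _. 0"])
            (simp add: point_def int_pow_int F.e_closed)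
      next
        case (graph_axis \<gamma>)
        then show ?thesis
          by (intro exI[of _ "\<lambda>_. 0"] exI[of _ "\<lambda>_. 0"] exI[of _ "\<lambda>_. 0"] exI[of _ "\<gamma>"])
            (simp add: point_def int_pow_int F.e_closed)
      qed
    qed
  qed
  show ?thesis
  proof
    assume "perfect_code (cayley_digraph G S) C"
    then have "factorization G S\<^sub>0 C" using E.perfect_code_iff_factorization[OF SG C(2)] S\<^sub>0 by simp
    from E.factorization_canonical[OF this \<open>3 \<ge> q\<close> one0 C(1) gen0 proper]
    obtain e\<^sub>2 e\<^sub>3 where f: "pqq_frame G p q e\<^sub>1 e\<^sub>2 e\<^sub>3" "canonical_pair (point G e\<^sub>1 e\<^sub>2 e\<^sub>3) p q S\<^sub>0 C" by blast
    show "\<exists>e\<^sub>2\<in>carrier G. \<exists>e\<^sub>3\<in>carrier G. ?N e\<^sub>2 e\<^sub>3 \<and> ?D e\<^sub>2 e\<^sub>3"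
    proof (rule bexI[of _ e\<^sub>2], rule bexI[of _ e\<^sub>3], rule conjI)
      show "?N e\<^sub>2 e\<^sub>3" by (rule frame_generates[OF frames f(1)])
      show "?D e\<^sub>2 e\<^sub>3" by (rule iffD2[OF D[OF f(1)] f(2)])
      show "e\<^sub>2 \<in> carrier G" "e\<^sub>3 \<in> carrier G" using pqq_frame.e_closed[OF f(1)] by auto
    qed
  next
    assume "\<exists>e\<^sub>2\<in>carrier G. \<exists>e\<^sub>3\<in>carrier G. ?N e\<^sub>2 e\<^sub>3 \<and> ?D e\<^sub>2 e\<^sub>3"
    then obtain e\<^sub>2 e\<^sub>3 where N: "?N e\<^sub>2 e\<^sub>3" and d: "?D e\<^sub>2 e\<^sub>3" by (elim bexE conjE)
    have f: "pqq_frame G p q e\<^sub>1 e\<^sub>2 e\<^sub>3" by (rule generates_frame[OF frames N])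
    have "factorization G S\<^sub>0 C"
      by (rule pqq_frame.canonical_pair_factorization[OF f iffD1[OF D[OF f] d]])
    then show "perfect_code (cayley_digraph G S) C"
      using E.perfect_code_iff_factorization[OF SG C(2)] S\<^sub>0 by simp
  qed
qed

end
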